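(* Let $G=(A,B,E)$ be a bipartite graph with a proper edge coloring $\chi:E\to\{1,\dots,d\}$ and let $k\ge 2$. Then there exists a subgraph $G'=(A,B,E')$ of $G$ that contains no $(k',B)$-slow walk for any $2\le k'\le k$ and satisfies $|E'|>\frac{\log^{(k-1)}d}{4\cdot 240^{k-1}d}|E|$. Similarly, there exists a subgraph $G''=(A,B,E'')$ of $G$ that contains no $k'$-fast walk for any $2\le k'\le k$ and satisfies $|E''|>\frac{\log^{(k-1)}d}{4\cdot 240^{k-1}d}|E|$. (Colors of walks in the subgraphs are taken with respect to $\chi$.)
   Context: A bipartite graph is a triple $G=(A,B,E)$ with disjoint vertex sets $A,B$ and $E\subseteq A\times B$; it is simple. A proper edge coloring assigns colors so that adjacent edges get different colors. A walk of length $m$ is a sequence of vertices $v_0,\dots,v_m$ with $v_{i-1}v_i$ an edge for $1\le i\le m$ and $v_{i-2}\neq v_i$ for $2\le i\le m$ (no immediate backtracking); its coloring is $(\chi(v_0v_1),\dots,\chi(v_{m-1}v_m))$. For $k\ge2$, a $k$-fast walk is a walk of length $2k$ whose coloring $(c_1,\dots,c_{2k})$ satisfies $c_1>c_2>\dots>c_k<c_{k+1}<\dots<c_{2k}$ and $c_1\ge c_{2k}$. For $k\ge 2$, a $k$-slow walk is a walk of length $2k$ whose coloring satisfies: $c_{2j-1}>c_{2j}$ for $1\le j\le k/2$; $c_{2j}<c_{2j+1}$ for $1\le j<k/2$; $c_{2j-1}<c_{2j}$ for $k/2<j\le k$; $c_{2j}>c_{2j+1}$ for $k/2\le j<k$;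 and $c_1\ge c_{2k}$. A $k$-slow walk starting (i.e. with $v_0$) in $B$ is a $(k,B)$-slow walk. $\log$ is the binary logarithm and $\log^{(k)}$ the $k$ times iterated logarithm. *)

theory Defs
  imports Complex_Main "HOL-Library.FuncSet"
begin

definition bipartite_graph :: "'v set \<Rightarrow> 'v set \<Rightarrow> ('v \<times> 'v) set \<Rightarrow> bool" where
  "bipartite_graph A B E \<longleftrightarrow> finite A \<and> finite B \<and> A \<inter> B = {} \<and> E \<subseteq> A \<times> B"

text \<open>Since \<open>A\<close> and \<open>B\<close> are disjoint, two distinct edges are adjacent iff they share their
  first or their second component.\<close>

definition proper_edge_coloring :: "('v \<times> 'v) set \<Rightarrow> ('v \<times> 'v \<Rightarrow> nat) \<Rightarrow> nat \<Rightarrow> bool" where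
  "proper_edge_coloring E \<chi> d \<longleftrightarrow>
     \<chi> \<in> E \<rightarrow> {1..d} \<and>
     (\<forall>e\<in>E. \<forall>f\<in>E. e \<noteq> f \<and> (fst e = fst f \<or> snd e = snd f) \<longrightarrow> \<chi> e \<noteq> \<chi> f)"

text \<open>Edges are stored as pairs in \<open>A \<times> B\<close>, but walks traverse them in both directions.\<close>

definition adj :: "('v \<times> 'v) set \<Rightarrow> 'v \<Rightarrow> 'v \<Rightarrow> bool" where
  "adj E u v \<longleftrightarrow> (u, v) \<in> E \<or> (v, u) \<in> E"

definition edge_color :: "('v \<times> 'v) set \<Rightarrow> ('v \<times> 'v \<Rightarrow> nat) \<Rightarrow> 'v \<Rightarrow> 'v \<Rightarrow> nat" where
  "edge_color E \<chi> u v = (if (u, v) \<in> E then \<chi> (u, v) else \<chi> (v, u))"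

text \<open>A walk of length \<open>m\<close> is the list of its \<open>m + 1\<close> vertices \<open>v\<^sub>0, \<dots>, v\<^sub>m\<close>.\<close>

definition is_walk :: "'v set \<Rightarrow> 'v set \<Rightarrow> ('v \<times> 'v) set \<Rightarrow> nat \<Rightarrow> 'v list \<Rightarrow> bool" where
  "is_walk A B E m vs \<longleftrightarrow>
     length vs = m + 1 \<and> set vs \<subseteq> A \<union> B \<and>
     (\<forall>i\<in>{1..m}. adj E (vs ! (i - 1)) (vs ! i)) \<and>
     (\<forall>i\<in>{2..m}. vs ! (i - 2) \<noteq> vs ! i)"

text \<open>The coloring \<open>(c\<^sub>1, \<dots>, c\<^sub>m)\<close> of a walk, indexed from 1.\<close>

definition walk_coloring ::
    "('v \<times> 'v) set \<Rightarrow> ('v \<times> 'v \<Rightarrow> nat) \<Rightarrow> 'v list \<Rightarrow> nat \<Rightarrow> nat" where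
  "walk_coloring E \<chi> vs i = edge_color E \<chi> (vs ! (i - 1)) (vs ! i)"

definition fast_coloring :: "nat \<Rightarrow> (nat \<Rightarrow> nat) \<Rightarrow> bool" where
  "fast_coloring k c \<longleftrightarrow>
     (\<forall>i. 1 \<le> i \<and> i < k \<longrightarrow> c i > c (i + 1)) \<and>
     (\<forall>i. k \<le> i \<and> i < 2 * k \<longrightarrow> c i < c (i + 1)) \<and>
     c 1 \<ge> c (2 * k)"

text \<open>Comparisons of \<open>j\<close> with \<open>k/2\<close> are cleared of the denominator.\<close>

definition slow_coloring :: "nat \<Rightarrow> (nat \<Rightarrow> nat) \<Rightarrow> bool" where
  "slow_coloring k c \<longleftrightarrow>
     (\<forall>j. 1 \<le> j \<and> 2 * j \<le> k \<longrightarrow> c (2 * j - 1) > c (2 * j)) \<and>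
     (\<forall>j. 1 \<le> j \<and> 2 * j < k \<longrightarrow> c (2 * j) < c (2 * j + 1)) \<and>
     (\<forall>j. k < 2 * j \<and> j \<le> k \<longrightarrow> c (2 * j - 1) < c (2 * j)) \<and>
     (\<forall>j. k \<le> 2 * j \<and> j < k \<longrightarrow> c (2 * j) > c (2 * j + 1)) \<and>
     c 1 \<ge> c (2 * k)"

definition fast_walk ::
    "'v set \<Rightarrow> 'v set \<Rightarrow> ('v \<times> 'v) set \<Rightarrow> ('v \<times> 'v \<Rightarrow> nat) \<Rightarrow> nat \<Rightarrow> 'v list \<Rightarrow> bool" where
  "fast_walk A B E \<chi> k vs \<longleftrightarrow>
     is_walk A B E (2 * k) vs \<and> fast_coloring k (walk_coloring E \<chi> vs)"

definition slow_walk ::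
    "'v set \<Rightarrow> 'v set \<Rightarrow> ('v \<times> 'v) set \<Rightarrow> ('v \<times> 'v \<Rightarrow> nat) \<Rightarrow> nat \<Rightarrow> 'v list \<Rightarrow> bool" where
  "slow_walk A B E \<chi> k vs \<longleftrightarrow>
     is_walk A B E (2 * k) vs \<and> slow_coloring k (walk_coloring E \<chi> vs)"

definition B_slow_walk ::
    "'v set \<Rightarrow> 'v set \<Rightarrow> ('v \<times> 'v) set \<Rightarrow> ('v \<times> 'v \<Rightarrow> nat) \<Rightarrow> nat \<Rightarrow> 'v list \<Rightarrow> bool" where
  "B_slow_walk A B E \<chi> k vs \<longleftrightarrow> slow_walk A B E \<chi> k vs \<and> vs ! 0 \<in> B"

text \<open>The \<open>n\<close> times iterated binary logarithm.  It is mathematically undefined as soon as an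
  earlier iterate is not positive; it then takes the value 0, rather than whatever the total
  function \<^const>\<open>log\<close> returns outside the positive reals.\<close>

fun iterated_log :: "nat \<Rightarrow> real \<Rightarrow> real" where
  "iterated_log 0 x = x"
| "iterated_log (Suc n) x = (if iterated_log n x > 0 then log 2 (iterated_log n x) else 0)"

lemma iterated_log_eq_funpow:
  assumes "\<forall>i<n. (log 2 ^^ i) x > 0"
  shows "iterated_log n x = (log 2 ^^ n) x"
  using assms by (induction n) auto

end

theory Submission
  imports Defs
begin

text \<open>
  One thinning step trades the \<open>d\<close> colours for about \<open>log d\<close> levels.  Give every vertex \<open>v\<close> a random
  number \<open>z v\<close> and let \<open>c\<close> be a colour shifted by a common offset.  For the slow case keep an edge
  \<open>(a, b)\<close> at level \<open>p\<close> if, in base 3, the numbers \<open>c\<close>, \<open>z b\<close>, \<open>z a\<close> agree above position \<open>p\<close> and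
  have the digits 0, 1, 2 there.  Further digits of \<open>z b\<close> are prescribed so that an edge is kept at
  each of its levels with probability of order \<open>1 / d\<close>.
  Removing the few adjacent edges of equal level makes the level a proper edge colouring.

  At a vertex, smaller colours then have larger levels, and at the largest level \<open>P\<close> of a walk the
  number \<open>z v div 3 ^ P\<close> changes only along edges of level \<open>P\<close>, by \<open>+1\<close> from \<open>B\<close> to \<open>A\<close>.
  If a slow walk from \<open>B\<close> used level \<open>P\<close> only in that direction, its last colour would exceed its
  first one.  So some edge of level \<open>P\<close> is traversed from \<open>A\<close> to \<open>B\<close>, and from there to the mirror
  position the levels form a shorter slow walk, now starting in \<open>A\<close>.  Iterating with the two sides
  exchanged until 1-slow walks, which do not exist, proves the slow case.

  For fast walks, \<open>c\<close> and \<open>z b\<close> agree above the coarse binary position \<open>p\<close>, while \<open>c\<close> and \<open>z a\<close>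
  agree above the fine position \<open>m - p\<close>.  The order of the levels is then reversed at \<open>B\<close> and
  preserved at \<open>A\<close>, which turns a \<open>k\<close>-fast walk into a shorter slow walk from \<open>B\<close>, so one step
  followed by the slow case suffices.  When the iterated logarithm is too small for a step, the
  largest colour class already has enough edges.
\<close>

subsection \<open>Walks and levels\<close>

text \<open>Indexed by the step from position \<open>i\<close> to \<open>i + 1\<close>, the four
  clauses collapse to one parity rule that flips at the middle \<open>k\<close>. In this form,
  cutting both ends of a walk only shifts \<open>i\<close> and \<open>k\<close> together.\<close>

lemma slow_coloring_iff:
  "slow_coloring k c \<longleftrightarrow>
     (\<forall>i. 1 \<le> i \<and> i < 2 * k \<longrightarrow> (if odd i \<longleftrightarrow> i < k then c i > c (i + 1) else c i < c (i + 1))) \<and>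
     c 1 \<ge> c (2 * k)" (is "_ \<longleftrightarrow> ?R")
proof
  assume s: "slow_coloring k c"
  have "if odd i \<longleftrightarrow> i < k then c i > c (i + 1) else c i < c (i + 1)"
    if i: "1 \<le> i" "i < 2 * k" for i
  proof (cases "even i")
    case True
    then obtain j where j: "i = 2 * j" by blast
    then show ?thesis using s i by (auto simp: slow_coloring_def)
  next
    case False
    then obtain j where j: "i = 2 * j + 1" using oddE by blast
    have "1 \<le> j + 1 \<and> 2 * (j + 1) \<le> k \<longrightarrow> c (2 * (j + 1) - 1) > c (2 * (j + 1))"
      "k < 2 * (j + 1) \<and> j + 1 \<le> k \<longrightarrow> c (2 * (j + 1) - 1) < c (2 * (j + 1))"
      using s unfolding slow_coloring_def by blast+
    then show ?thesis using i j by auto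
  qed
  moreover have "c 1 \<ge> c (2 * k)" using s by (simp add: slow_coloring_def)
  ultimately show ?R by blast
next
  assume R: ?R
  have r: "if odd i \<longleftrightarrow> i < k then c i > c (i + 1) else c i < c (i + 1)"
    if "1 \<le> i" "i < 2 * k" for i using R that by blast
  show "slow_coloring k c"
    unfolding slow_coloring_def
  proof (intro conjI allI impI)
    fix j assume j: "1 \<le> j \<and> 2 * j \<le> k"
    then show "c (2 * j) < c (2 * j - 1)" using r[of "2 * j - 1"] by (cases j) auto
  next
    fix j assume j: "1 \<le> j \<and> 2 * j < k"
    then show "c (2 * j) < c (2 * j + 1)" using r[of "2 * j"] by auto
  next
    fix j assume j: "k < 2 * j \<and> j \<le> k"
    then show "c (2 * j - 1) < c (2 * j)" using r[of "2 * j - 1"] by (cases j) auto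
  next
    fix j assume j: "k \<le> 2 * j \<and> j < k"
    then show "c (2 * j + 1) < c (2 * j)" using r[of "2 * j"] by auto
  next
    show "c (2 * k) \<le> c 1" using R by blast
  qed
qed

text \<open>The only step ascends, against the comparison of the ends. This is what finally stops
  the descent, and it keeps all shorter walks at \<open>k' \<ge> 2\<close>.\<close>

lemma not_slow_coloring_one: "\<not> slow_coloring 1 c"
proof
  assume "slow_coloring 1 c"
  then have r: "\<forall>i. 1 \<le> i \<and> i < 2 * 1 \<longrightarrow> (if odd i \<longleftrightarrow> i < 1 then c i > c (i + 1) else c i < c (i + 1))"
    and ends: "c 1 \<ge> c (2 * 1)"
    unfolding slow_coloring_iff by blast+
  show False using r[rule_format, of 1] ends by (simp add: numeral_2_eq_2)
qed

text \<open>The edge number \<open>t\<close> of a walk, counted from 1 like the colouring, in its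
  stored orientation. Thus \<open>fst\<close> is its end in \<open>A\<close> and \<open>snd\<close>
  its end in \<open>B\<close>, whichever way it is traversed.\<close>

definition walk_edge :: "('v \<times> 'v) set \<Rightarrow> 'v list \<Rightarrow> nat \<Rightarrow> 'v \<times> 'v" where
  "walk_edge E vs t = (if (vs ! (t - 1), vs ! t) \<in> E then (vs ! (t - 1), vs ! t) else (vs ! t, vs ! (t - 1)))"

lemma walk_coloring_eq: "walk_coloring E \<chi> vs t = \<chi> (walk_edge E vs t)"
  by (simp add: walk_coloring_def edge_color_def walk_edge_def)

section \<open>Walks in a bipartite graph: alternating sides and consecutive edges\<close>

context
  fixes A B :: "'v set" and E :: "('v \<times> 'v) set" and m :: nat and vs :: "'v list"
  assumes bip: "bipartite_graph A B E" and walk: "is_walk A B E m vs"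
begin

lemma walk_in_A_iff: "i \<le> m \<Longrightarrow> vs ! i \<in> A \<longleftrightarrow> vs ! i \<notin> B"
proof -
  assume "i \<le> m"
  then have "vs ! i \<in> set vs" using walk by (auto simp: is_walk_def)
  then show ?thesis using walk bip by (auto simp: is_walk_def bipartite_graph_def)
qed

lemma walk_adj: "i < m \<Longrightarrow> (vs ! i, vs ! Suc i) \<in> E \<or> (vs ! Suc i, vs ! i) \<in> E"
proof -
  assume "i < m"
  then have "Suc i \<in> {1..m}" by auto
  then have "adj E (vs ! (Suc i - 1)) (vs ! Suc i)" using walk unfolding is_walk_def by blast
  then show ?thesis by (simp add: adj_def)
qed

lemma walk_in_B_iff: "i \<le> m \<Longrightarrow> vs ! i \<in> B \<longleftrightarrow> (vs ! 0 \<in> B \<longleftrightarrow> even i)"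
proof (induction i)
  case (Suc i)
  have "vs ! Suc i \<in> B \<longleftrightarrow> vs ! i \<notin> B"
    using walk_adj[of i] Suc.prems bip by (auto simp: bipartite_graph_def)
  then show ?case using Suc by auto
qed simp

lemma walk_edge_from_A:
  assumes "i < m" "vs ! i \<in> A"
  shows "walk_edge E vs (Suc i) = (vs ! i, vs ! Suc i)" "(vs ! i, vs ! Suc i) \<in> E"
  using walk_adj[of i] assms bip by (auto simp: bipartite_graph_def walk_edge_def)

lemma walk_edge_from_B:
  assumes "i < m" "vs ! i \<in> B"
  shows "walk_edge E vs (Suc i) = (vs ! Suc i, vs ! i)" "(vs ! Suc i, vs ! i) \<in> E"
  using walk_adj[of i] assms bip by (auto simp: bipartite_graph_def walk_edge_def)

lemma walk_edge_mem: "1 \<le> t \<Longrightarrow> t \<le> m \<Longrightarrow> walk_edge E vs t \<in> E"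
  using walk_adj[of "t - 1"] by (auto simp: walk_edge_def)

lemma walk_no_backtrack: "i + 2 \<le> m \<Longrightarrow> vs ! i \<noteq> vs ! (i + 2)"
  using walk unfolding is_walk_def
  by (metis add_diff_cancel_right' atLeastAtMost_iff le_add2)

text \<open>The ban on immediate backtracking makes the two edges at an inner vertex distinct, so
  that properness applies to them.\<close>

lemma walk_edge_consec_at_A:
  assumes "1 \<le> i" "i < m" "vs ! i \<in> A"
  shows "fst (walk_edge E vs i) = fst (walk_edge E vs (Suc i))" "walk_edge E vs i \<noteq> walk_edge E vs (Suc i)"
proof -
  obtain j where j: "i = Suc j" using assms(1) by (cases i) auto
  have "vs ! j \<in> B" using assms j walk_in_A_iff[of i] walk_in_B_iff[of i] walk_in_B_iff[of j] by auto
  then show "fst (walk_edge E vs i) = fst (walk_edge E vs (Suc i))" "walk_edge E vs i \<noteq> walk_edge E vs (Suc i)"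
    using walk_edge_from_B[of j] walk_edge_from_A[of i] walk_no_backtrack[of j] assms j by auto
qed

lemma walk_edge_consec_at_B:
  assumes "1 \<le> i" "i < m" "vs ! i \<in> B"
  shows "snd (walk_edge E vs i) = snd (walk_edge E vs (Suc i))" "walk_edge E vs i \<noteq> walk_edge E vs (Suc i)"
proof -
  obtain j where j: "i = Suc j" using assms(1) by (cases i) auto
  have "vs ! j \<in> A" using assms j walk_in_A_iff[of j] walk_in_B_iff[of i] walk_in_B_iff[of j] by auto
  then show "snd (walk_edge E vs i) = snd (walk_edge E vs (Suc i))" "walk_edge E vs i \<noteq> walk_edge E vs (Suc i)"
    using walk_edge_from_A[of j] walk_edge_from_B[of i] walk_no_backtrack[of j] assms j by auto
qed

lemma walk_edge_consec:
  assumes "1 \<le> i" "i < m"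
  shows "walk_edge E vs i \<noteq> walk_edge E vs (Suc i)"
    "fst (walk_edge E vs i) = fst (walk_edge E vs (Suc i)) \<or> snd (walk_edge E vs i) = snd (walk_edge E vs (Suc i))"
  using walk_edge_consec_at_A[of i] walk_edge_consec_at_B[of i] walk_in_A_iff[of i] assms by auto

end

section \<open>Descent from walks in the colours to shorter slow walks in the levels\<close>

text \<open>Cutting \<open>s\<close> edges off both ends keeps the middle, so the slow pattern
  reappears with \<open>i - s\<close> and \<open>k - s\<close>. Only the comparison of the new end
  edges must be supplied; both descents obtain it by starting at an edge of maximal level.\<close>

lemma slow_subwalk:
  assumes walk: "is_walk A B E (2 * k) vs" and s: "1 \<le> s" "s < k"
    and dir: "\<And>i. s < i \<Longrightarrow> i < 2 * k - s \<Longrightarrow>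
       (if odd (i - s) \<longleftrightarrow> i < k then walk_coloring E \<chi> vs i > walk_coloring E \<chi> vs (i + 1)
        else walk_coloring E \<chi> vs i < walk_coloring E \<chi> vs (i + 1))"
    and ends: "walk_coloring E \<chi> vs (s + 1) \<ge> walk_coloring E \<chi> vs (2 * k - s)"
  shows "\<exists>k' us. 2 \<le> k' \<and> k' < k \<and> slow_walk A B E \<chi> k' us \<and> us ! 0 = vs ! s"
proof -
  define us where "us = take (2 * (k - s) + 1) (drop s vs)"
  have len: "length vs = 2 * k + 1" using walk by (simp add: is_walk_def)
  have nth: "us ! i = vs ! (s + i)" if "i \<le> 2 * (k - s)" for i
    using that len s by (simp add: us_def)
  have sub: "set us \<subseteq> set vs"
    unfolding us_def by (meson order_trans set_drop_subset set_take_subset)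
  have adj: "adj E (us ! (i - 1)) (us ! i)" if i: "i \<in> {1..2 * (k - s)}" for i
  proof -
    have "s + i \<in> {1..2 * k}" using i s by auto
    then have "adj E (vs ! (s + i - 1)) (vs ! (s + i))" using walk unfolding is_walk_def by blast
    moreover have "s + i - 1 = s + (i - 1)" "i \<le> 2 * (k - s)" "i - 1 \<le> 2 * (k - s)" using i by auto
    ultimately show ?thesis using nth[of i] nth[of "i - 1"] by metis
  qed
  have nb: "us ! (i - 2) \<noteq> us ! i" if i: "i \<in> {2..2 * (k - s)}" for i
  proof -
    have "s + i \<in> {2..2 * k}" using i s by auto
    then have "vs ! (s + i - 2) \<noteq> vs ! (s + i)" using walk unfolding is_walk_def by blast
    moreover have "s + i - 2 = s + (i - 2)" "i \<le> 2 * (k - s)" "i - 2 \<le> 2 * (k - s)" using i by auto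
    ultimately show ?thesis using nth[of i] nth[of "i - 2"] by metis
  qed
  have w: "is_walk A B E (2 * (k - s)) us"
    using walk len sub adj nb s unfolding is_walk_def us_def by auto
  have col: "walk_coloring E \<chi> us i = walk_coloring E \<chi> vs (s + i)" if "1 \<le> i" "i \<le> 2 * (k - s)" for i
  proof -
    have "s + i - 1 = s + (i - 1)" "i - 1 \<le> 2 * (k - s)" using that by auto
    then have "vs ! (s + i - 1) = us ! (i - 1)" using nth[of "i - 1"] by metis
    then show ?thesis using nth[of i] that by (simp only: walk_coloring_def)
  qed
  have "slow_coloring (k - s) (walk_coloring E \<chi> us)"
    unfolding slow_coloring_iff
  proof (intro conjI allI impI)
    fix i assume i: "1 \<le> i \<and> i < 2 * (k - s)"
    have "s + i < k \<longleftrightarrow> i < k - s" "s < s + i" "s + i < 2 * k - s" using i s by auto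
    then show "if odd i = (i < k - s) then walk_coloring E \<chi> us (i + 1) < walk_coloring E \<chi> us i
         else walk_coloring E \<chi> us i < walk_coloring E \<chi> us (i + 1)"
      using dir[of "s + i"] i col[of i] col[of "i + 1"] s by (auto split: if_splits)
  next
    have "s + 2 * (k - s) = 2 * k - s" using s by auto
    then show "walk_coloring E \<chi> us (2 * (k - s)) \<le> walk_coloring E \<chi> us 1"
      using ends col[of 1] col[of "2 * (k - s)"] s by auto
  qed
  moreover from this have "k - s \<noteq> 1" using not_slow_coloring_one by metis
  ultimately show ?thesis
    using w nth[of 0] s unfolding slow_walk_def by (intro exI[of _ "k - s"] exI[of _ us]) auto
qed

lemma strict_increase:
  fixes f :: "nat \<Rightarrow> nat"
  assumes "\<And>t. i < t \<Longrightarrow> t \<le> j \<Longrightarrow> f (t - 1) \<le> f t"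
    and "i < u" "u \<le> j" "f (u - 1) < f u"
  shows "f i < f j"
proof -
  have mono: "f x \<le> f y" if "i \<le> x" "x \<le> y" "y \<le> j" for x y
    using that(2,3)
  proof (induction y rule: dec_induct)
    case (step n)
    then show ?case using assms(1)[of "Suc n"] that by auto
  qed simp
  show ?thesis using mono[of i "u - 1"] mono[of u j] assms(2-4) by linarith
qed

text \<open>\<open>val P v\<close> and \<open>cv P c\<close> stand for the vertex number and the
  shifted colour with the digits below \<open>P\<close> cut off. The excess over the colour, 2 at
  \<open>A\<close> against 1 at \<open>B\<close>, produces the drift of \<open>val P\<close> along
  edges of level \<open>P\<close>.\<close>

lemma slow_walk_descent:
  fixes val :: "nat \<Rightarrow> 'v \<Rightarrow> nat" and cv :: "nat \<Rightarrow> nat \<Rightarrow> nat"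
  assumes bip: "bipartite_graph A B E"
    and proper: "\<And>e f. e \<in> E \<Longrightarrow> f \<in> E \<Longrightarrow> e \<noteq> f \<Longrightarrow> fst e = fst f \<or> snd e = snd f \<Longrightarrow> lev e \<noteq> lev f"
    and fine: "\<And>e P. e \<in> E \<Longrightarrow> lev e < P \<Longrightarrow> val P (fst e) = cv P (\<chi> e) \<and> val P (snd e) = cv P (\<chi> e)"
    and eqA: "\<And>e. e \<in> E \<Longrightarrow> val (lev e) (fst e) = cv (lev e) (\<chi> e) + 2"
    and eqB: "\<And>e. e \<in> E \<Longrightarrow> val (lev e) (snd e) = cv (lev e) (\<chi> e) + 1"
    and mono: "\<And>P. mono (cv P)"
    and k: "k \<ge> 2" and slow: "B_slow_walk A B E \<chi> k vs"
  shows "\<exists>k' us. 2 \<le> k' \<and> k' < k \<and> slow_walk A B E lev k' us \<and> us ! 0 \<in> A"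
proof -
  have walk: "is_walk A B E (2 * k) vs" and start: "vs ! 0 \<in> B"
    and sc: "slow_coloring k (walk_coloring E \<chi> vs)"
    using slow by (auto simp: B_slow_walk_def slow_walk_def)
  define e where "e = walk_edge E vs"
  define p where "p t = lev (e t)" for t
  have eE: "e t \<in> E" if "1 \<le> t" "t \<le> 2 * k" for t
    using walk_edge_mem[OF bip walk that] by (simp add: e_def)
  \<comment> \<open>At \<open>lev f\<close>, the value of the common vertex exceeds the cut colour
    of \<open>f\<close> and equals that of \<open>g\<close>. Hence smaller colours have larger
    levels.\<close>
  have lt: "\<chi> f < \<chi> g" if "f \<in> E" "g \<in> E" "fst f = fst g \<or> snd f = snd g" "lev g < lev f" for f g
  proof -
    have "cv (lev f) (\<chi> f) < cv (lev f) (\<chi> g)"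
      using fine[of g "lev f"] eqA[of f] eqB[of f] that by auto
    then show ?thesis using monoD[OF mono[of "lev f"]] by (meson not_le)
  qed
  have consec: "(p i < p (i + 1) \<and> \<chi> (e i) > \<chi> (e (i + 1))) \<or> (p i > p (i + 1) \<and> \<chi> (e i) < \<chi> (e (i + 1)))"
    if i: "1 \<le> i" "i < 2 * k" for i
  proof -
    have "e i \<noteq> e (i + 1)" "fst (e i) = fst (e (i + 1)) \<or> snd (e i) = snd (e (i + 1))"
      using walk_edge_consec[OF bip walk i] by (auto simp: e_def)
    moreover have "e i \<in> E" "e (i + 1) \<in> E" using eE[of i] eE[of "i + 1"] i by auto
    moreover have "p i < p (i + 1) \<or> p (i + 1) < p i"
      using proper[OF calculation(3,4,1,2)] unfolding p_def by linarith
    ultimately show ?thesis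
      using lt[of "e i" "e (i + 1)"] lt[of "e (i + 1)" "e i"] unfolding p_def by metis
  qed
  have dir: "if odd i \<longleftrightarrow> i < k then p i < p (i + 1) else p i > p (i + 1)"
    if i: "1 \<le> i" "i < 2 * k" for i
    using sc i consec[OF i] unfolding slow_coloring_iff walk_coloring_eq e_def[symmetric]
    by (metis less_asym)
  have ends: "\<chi> (e 1) \<ge> \<chi> (e (2 * k))"
    using sc unfolding slow_coloring_iff walk_coloring_eq e_def[symmetric] by blast
  define P where "P = Max (p ` {1..2 * k})"
  have fin: "finite (p ` {1..2 * k})" "p ` {1..2 * k} \<noteq> {}" using k by auto
  have le: "p t \<le> P" if "1 \<le> t" "t \<le> 2 * k" for t
    using fin that by (auto simp: P_def)
  obtain u where u: "1 \<le> u" "u \<le> 2 * k" "p u = P"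
    using Max_in[OF fin] unfolding P_def by auto
  \<comment> \<open>Odd positions are the edges traversed from \<open>B\<close> to \<open>A\<close>.
    If only these had level \<open>P\<close>, then \<open>val P\<close> would never drop along the
    walk and would rise at edge \<open>u\<close>. Both end edges lie below \<open>P\<close>, so the
    end values are their cut colours, against \<open>ends\<close>.\<close>
  have "\<exists>t. even t \<and> 1 \<le> t \<and> t \<le> 2 * k \<and> p t = P"
  proof (rule ccontr)
    assume none: "\<not> ?thesis"
    define f where "f t = val P (vs ! t)" for t
    have even: "f (t - 1) = f t \<and> f t = cv P (\<chi> (e t))" if t: "1 \<le> t" "t \<le> 2 * k" "even t \<or> p t < P" for t
    proof -
      have "p t < P" using t none le[of t] by (metis le_neq_implies_less)
      then have "val P (fst (e t)) = cv P (\<chi> (e t))" "val P (snd (e t)) = cv P (\<chi> (e t))"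
        using fine[of "e t" P] eE[of t] t by (auto simp: p_def)
      then show ?thesis unfolding f_def e_def walk_edge_def by (auto split: if_splits)
    qed
    have odd: "f t = f (t - 1) + 1" if t: "1 \<le> t" "t \<le> 2 * k" "odd t" "p t = P" for t
    proof -
      obtain i where i: "t = Suc i" using t(1) by (cases t) auto
      have "vs ! i \<in> B" using walk_in_B_iff[OF bip walk, of i] start i t by auto
      then have "e t = (vs ! t, vs ! (t - 1))"
        using walk_edge_from_B[OF bip walk, of i] i t by (auto simp: e_def)
      then show ?thesis using eqA[of "e t"] eqB[of "e t"] eE[of t] t by (auto simp: f_def p_def)
    qed
    have "odd u" using none u by auto
    have "f 0 < f (2 * k)"
    proof (rule strict_increase[of 0 "2 * k" f u])
      fix t assume t: "0 < t" "t \<le> 2 * k"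
      show "f (t - 1) \<le> f t"
        using even[of t] odd[of t] le[of t] t by (cases "even t \<or> p t < P") auto
    qed (use u \<open>odd u\<close> odd[of u] in auto)
    moreover have "p 1 < p 2" using dir[of 1] k by (auto simp: numeral_2_eq_2)
    then have "f 0 = cv P (\<chi> (e 1))" using even[of 1] le[of 2] k by auto
    moreover have "f (2 * k) = cv P (\<chi> (e (2 * k)))" using even[of "2 * k"] k by auto
    ultimately show False using ends monoD[OF mono[of P] ends] by auto
  qed
  then obtain t where t: "even t" "1 \<le> t" "t \<le> 2 * k" "p t = P" by blast
  have "t \<noteq> 2 * k"
  proof
    assume "t = 2 * k"
    moreover have "p (2 * k - 1) > p (2 * k)"
    proof -
      have "odd (2 * k - 1)" "\<not> 2 * k - 1 < k" "2 * k - 1 + 1 = 2 * k" "1 \<le> 2 * k - 1" "2 * k - 1 < 2 * k"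
        using k by auto
      then show ?thesis using dir[of "2 * k - 1"] by metis
    qed
    moreover have "1 \<le> 2 * k - 1" using k by linarith
    ultimately show False using le[of "2 * k - 1"] t by auto
  qed
  \<comment> \<open>From the middle on, the levels ascend after an even position, which the
    maximality of \<open>P\<close> forbids.\<close>
  then have tk: "t < k"
    using dir[of t] t le[of "t + 1"] by (auto split: if_splits)
  \<comment> \<open>The walk restarts at the \<open>A\<close>-end of edge \<open>t\<close>. Since
    \<open>s\<close> is odd, the shift flips the parity rule, and the reversed order of the levels
    flips it back.\<close>
  define s where "s = t - 1"
  have s: "s < k" "odd s" "t = s + 1" "1 \<le> s" using t tk by (auto simp: s_def elim: evenE)
  have "\<exists>k' us. 2 \<le> k' \<and> k' < k \<and> slow_walk A B E lev k' us \<and> us ! 0 = vs ! s"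
  proof (rule slow_subwalk[OF walk s(4,1)])
    fix i assume i: "s < i" "i < 2 * k - s"
    have "odd (i - s) \<longleftrightarrow> even i" "1 \<le> i" "i < 2 * k" using i s by auto
    then show "if odd (i - s) \<longleftrightarrow> i < k then walk_coloring E lev vs i > walk_coloring E lev vs (i + 1)
        else walk_coloring E lev vs i < walk_coloring E lev vs (i + 1)"
      using dir[of i] i unfolding walk_coloring_eq p_def e_def[symmetric] by auto
  next
    show "walk_coloring E lev vs (2 * k - s) \<le> walk_coloring E lev vs (s + 1)"
      using le[of "2 * k - s"] t s unfolding walk_coloring_eq p_def e_def[symmetric] by auto
  qed
  moreover have "vs ! s \<in> A"
    using walk_in_A_iff[OF bip walk, of s] walk_in_B_iff[OF bip walk, of s] start s by auto
  ultimately show ?thesis by metis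
qed

text \<open>The order of the levels is kept at \<open>A\<close> and reversed at \<open>B\<close>, so
  the two monotone halves of a fast walk become alternating ones, and every centred part that starts
  in \<open>B\<close> has the slow pattern. The hypothesis \<open>valA\<close> covers all pairs of
  edges because the agreement at \<open>A\<close> reaches below every level in use.\<close>

lemma fast_walk_descent:
  fixes val :: "nat \<Rightarrow> 'v \<Rightarrow> nat" and cv :: "nat \<Rightarrow> nat \<Rightarrow> nat"
  assumes bip: "bipartite_graph A B E"
    and proper: "\<And>e f. e \<in> E \<Longrightarrow> f \<in> E \<Longrightarrow> e \<noteq> f \<Longrightarrow> fst e = fst f \<or> snd e = snd f \<Longrightarrow> lev e \<noteq> lev f"
    and ordA: "\<And>e f. e \<in> E \<Longrightarrow> f \<in> E \<Longrightarrow> fst e = fst f \<Longrightarrow> lev e < lev f \<Longrightarrow> \<chi> e < \<chi> f"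
    and valA: "\<And>e f. e \<in> E \<Longrightarrow> f \<in> E \<Longrightarrow> val (lev f) (fst e) = cv (lev f) (\<chi> e)"
    and fineB: "\<And>e f. e \<in> E \<Longrightarrow> f \<in> E \<Longrightarrow> lev e < lev f \<Longrightarrow> val (lev f) (snd e) = cv (lev f) (\<chi> e)"
    and eqB: "\<And>e. e \<in> E \<Longrightarrow> val (lev e) (snd e) = cv (lev e) (\<chi> e) + 1"
    and mono: "\<And>P. mono (cv P)"
    and k: "k \<ge> 2" and fast: "fast_walk A B E \<chi> k vs"
  shows "\<exists>k' us. 2 \<le> k' \<and> k' < k \<and> slow_walk A B E lev k' us \<and> us ! 0 \<in> B"
proof -
  have walk: "is_walk A B E (2 * k) vs" and fc: "fast_coloring k (walk_coloring E \<chi> vs)"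
    using fast by (auto simp: fast_walk_def)
  define e where "e = walk_edge E vs"
  define p where "p t = lev (e t)" for t
  have eE: "e t \<in> E" if "1 \<le> t" "t \<le> 2 * k" for t
    using walk_edge_mem[OF bip walk that] by (simp add: e_def)
  have B_iff: "vs ! i \<in> B \<longleftrightarrow> (vs ! 0 \<in> B \<longleftrightarrow> even i)" if "i \<le> 2 * k" for i
    using walk_in_B_iff[OF bip walk that] .
  have A_iff: "vs ! i \<in> A \<longleftrightarrow> vs ! i \<notin> B" if "i \<le> 2 * k" for i
    using walk_in_A_iff[OF bip walk that] .
  have ordB: "\<chi> f < \<chi> g" if "f \<in> E" "g \<in> E" "snd f = snd g" "lev g < lev f" for f g
  proof -
    have "cv (lev f) (\<chi> f) < cv (lev f) (\<chi> g)"
      using fineB[of g f] eqB[of f] that by auto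
    then show ?thesis using monoD[OF mono[of "lev f"]] by (meson not_le)
  qed
  have col: "if i < k then \<chi> (e i) > \<chi> (e (i + 1)) else \<chi> (e i) < \<chi> (e (i + 1))"
    if "1 \<le> i" "i < 2 * k" for i
    using fc that unfolding fast_coloring_def walk_coloring_eq e_def[symmetric] by auto
  have ends: "\<chi> (e 1) \<ge> \<chi> (e (2 * k))"
    using fc unfolding fast_coloring_def walk_coloring_eq e_def[symmetric] by blast
  have dir: "if vs ! i \<in> A \<longleftrightarrow> i < k then p i > p (i + 1) else p i < p (i + 1)"
    if i: "1 \<le> i" "i < 2 * k" for i
  proof -
    have E2: "e i \<in> E" "e (i + 1) \<in> E" using eE[of i] eE[of "i + 1"] i by auto
    show ?thesis
    proof (cases "vs ! i \<in> A")
      case True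
      then have a: "fst (e i) = fst (e (i + 1))" "e i \<noteq> e (i + 1)"
        using walk_edge_consec_at_A[OF bip walk i] by (auto simp: e_def)
      then have "p i < p (i + 1) \<or> p (i + 1) < p i"
        using proper[OF E2] unfolding p_def by linarith
      then show ?thesis
        using ordA[OF E2 a(1)] ordA[OF E2(2,1) a(1)[symmetric]] col[OF i] True
        unfolding p_def by (metis less_asym)
    next
      case False
      then have a: "snd (e i) = snd (e (i + 1))" "e i \<noteq> e (i + 1)"
        using walk_edge_consec_at_B[OF bip walk i] A_iff[of i] i by (auto simp: e_def)
      then have "p i < p (i + 1) \<or> p (i + 1) < p i"
        using proper[OF E2] unfolding p_def by linarith
      then show ?thesis
        using ordB[OF E2 a(1)] ordB[OF E2(2,1) a(1)[symmetric]] col[OF i] False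
        unfolding p_def by (metis less_asym)
    qed
  qed
  \<comment> \<open>The walk is trimmed to the part between the \<open>A\<close>-ends of its first
    and last edges. By \<open>valA\<close> the values at these two vertices are the cut colours of
    the original end edges, even if those edges are trimmed away.\<close>
  define lo where "lo = (if vs ! 0 \<in> B then 1 else 0 :: nat)"
  define hi where "hi = 2 * k - lo"
  have lo_hi: "lo \<le> 1" "hi \<le> 2 * k" "2 * k \<le> hi + 1" "lo + hi = 2 * k" using k by (auto simp: lo_def hi_def)
  have even_hi: "even hi \<longleftrightarrow> even lo" using lo_hi(4) by presburger
  have parity: "vs ! i \<in> A \<longleftrightarrow> (even i \<longleftrightarrow> even lo)" if "i \<le> 2 * k" for i
    using A_iff[OF that] B_iff[OF that] by (auto simp: lo_def)
  define P where "P = Max (p ` {lo + 1..hi})"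
  have fin: "finite (p ` {lo + 1..hi})" "p ` {lo + 1..hi} \<noteq> {}" using k lo_hi by auto
  have le: "p t \<le> P" if "lo < t" "t \<le> hi" for t
    using fin that by (auto simp: P_def)
  obtain u where u: "lo < u" "u \<le> hi" "p u = P"
    using Max_in[OF fin] unfolding P_def by (metis (no_types, lifting) Suc_eq_plus1 Suc_le_eq atLeastAtMost_iff imageE)
  have uE: "e u \<in> E" "lev (e u) = P" using u eE[of u] lo_hi by (auto simp: p_def)
  \<comment> \<open>Otherwise level \<open>P\<close> is used only from \<open>A\<close> to
    \<open>B\<close>, where \<open>val P\<close> rises by 1, and \<open>val P\<close> is constant
    elsewhere; the last colour would then exceed the first.\<close>
  have "\<exists>t. lo < t \<and> t \<le> hi \<and> vs ! t \<in> A \<and> p t = P"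
  proof (rule ccontr)
    assume none: "\<not> ?thesis"
    define f where "f t = val P (vs ! t)" for t
    have flat: "f (t - 1) = f t" if t: "lo < t" "t \<le> hi" "p t < P" for t
    proof -
      have "e t \<in> E" using eE[of t] t lo_hi by auto
      then have "val P (fst (e t)) = val P (snd (e t))"
        using valA[of "e t" "e u"] fineB[of "e t" "e u"] uE t by (auto simp: p_def)
      then show ?thesis unfolding f_def e_def walk_edge_def by (auto split: if_splits)
    qed
    have up: "f t = f (t - 1) + 1" if t: "lo < t" "t \<le> hi" "p t = P" for t
    proof -
      obtain i where i: "t = Suc i" using t(1) by (cases t) auto
      have "vs ! t \<notin> A" using none t by auto
      then have "vs ! i \<in> A" using parity[of t] parity[of i] i t lo_hi by auto
      then have "e t = (vs ! (t - 1), vs ! t)"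
        using walk_edge_from_A[OF bip walk, of i] i t lo_hi by (auto simp: e_def)
      moreover have "e t \<in> E" using eE[of t] t lo_hi by auto
      ultimately show ?thesis using valA[of "e t" "e t"] eqB[of "e t"] t by (auto simp: f_def p_def)
    qed
    have "f lo < f hi"
    proof (rule strict_increase[of lo hi f u])
      fix t assume t: "lo < t" "t \<le> hi"
      show "f (t - 1) \<le> f t"
        using flat[of t] up[of t] le[of t] t by (cases "p t < P") auto
    qed (use u up[of u] in auto)
    moreover have "fst (e 1) = vs ! lo"
    proof (cases "vs ! 0 \<in> B")
      case True
      then show ?thesis using walk_edge_from_B[OF bip walk, of 0] k by (auto simp: lo_def e_def)
    next
      case False
      then show ?thesis using walk_edge_from_A[OF bip walk, of 0] A_iff[of 0] k by (auto simp: lo_def e_def)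
    qed
    then have "f lo = cv P (\<chi> (e 1))" using valA[of "e 1" "e u"] uE eE[of 1] k by (auto simp: f_def)
    moreover have "fst (e (2 * k)) = vs ! hi"
    proof -
      obtain j where j: "2 * k = Suc j" using k by (cases "2 * k") auto
      then have "odd j" by presburger
      show ?thesis
      proof (cases "vs ! j \<in> B")
        case True
        then show ?thesis
          using walk_edge_from_B[OF bip walk, of j] B_iff[of j] j \<open>odd j\<close> by (auto simp: lo_def hi_def e_def)
      next
        case False
        then show ?thesis
          using walk_edge_from_A[OF bip walk, of j] A_iff[of j] B_iff[of j] j \<open>odd j\<close> by (auto simp: lo_def hi_def e_def)
      qed
    qed
    then have "f hi = cv P (\<chi> (e (2 * k)))" using valA[of "e (2 * k)" "e u"] uE eE[of "2 * k"] k by (auto simp: f_def)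
    ultimately show False using monoD[OF mono[of P] ends] by auto
  qed
  then obtain t where t: "lo < t" "t \<le> hi" "vs ! t \<in> A" "p t = P" by blast
  have t_par: "even t \<longleftrightarrow> even lo" using parity[of t] t lo_hi by auto
  have "t \<noteq> hi"
  proof
    assume h: "t = hi"
    have "vs ! (hi - 1) \<notin> A" using parity[of "hi - 1"] lo_hi even_hi k by auto
    moreover have "1 \<le> hi - 1" "hi - 1 < 2 * k" "\<not> hi - 1 < k" "hi - 1 + 1 = hi" "lo < hi - 1"
      using lo_hi k by linarith+
    ultimately have "p (hi - 1) > p hi" using dir[of "hi - 1"] by metis
    then show False using le[of "hi - 1"] t h \<open>lo < hi - 1\<close> by auto
  qed
  then have tk: "t < k"
    using dir[of t] t le[of "t + 1"] lo_hi by (auto split: if_splits)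
  define s where "s = t - 1"
  \<comment> \<open>By parity at least one edge is cut off even from the trimmed walk, so the new
    walk is shorter and stays in the range over which \<open>P\<close> is the maximum.\<close>
  have "t \<noteq> lo + 1" using t_par by auto
  then have s: "1 \<le> s" "s < k" "t = s + 1" "lo < s" using t tk by (auto simp: s_def)
  have "\<exists>k' us. 2 \<le> k' \<and> k' < k \<and> slow_walk A B E lev k' us \<and> us ! 0 = vs ! s"
  proof (rule slow_subwalk[OF walk s(1,2)])
    fix i assume i: "s < i" "i < 2 * k - s"
    have "1 \<le> i" "i < 2 * k" using i by auto
    moreover have "odd (i - s) \<longleftrightarrow> vs ! i \<in> A" using i s t_par parity[of i] by auto
    ultimately show "if odd (i - s) \<longleftrightarrow> i < k then walk_coloring E lev vs i > walk_coloring E lev vs (i + 1)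
        else walk_coloring E lev vs i < walk_coloring E lev vs (i + 1)"
      using dir[of i] unfolding walk_coloring_eq p_def e_def[symmetric] by auto
  next
    show "walk_coloring E lev vs (2 * k - s) \<le> walk_coloring E lev vs (s + 1)"
      using le[of "2 * k - s"] t s lo_hi unfolding walk_coloring_eq p_def e_def[symmetric] by auto
  qed
  moreover have "vs ! s \<in> B" using A_iff[of s] parity[of s] t_par s by auto
  ultimately show ?thesis by metis
qed

subsection \<open>Random thinning\<close>

text \<open>Independence of the values of a uniformly random \<open>z\<close>, in the form of
  counting: each constrained vertex contributes its own probability as a factor.\<close>

lemma card_PiE_constrained:
  assumes "finite V" "finite Z" "Z \<noteq> {}" "K \<subseteq> V" "\<And>v. v \<in> K \<Longrightarrow> S v \<subseteq> Z"
  shows "real (card {z \<in> V \<rightarrow>\<^sub>E Z. \<forall>v\<in>K. z v \<in> S v}) =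
    real (card (V \<rightarrow>\<^sub>E Z)) * (\<Prod>v\<in>K. real (card (S v)) / real (card Z))"
proof -
  have eq: "{z \<in> V \<rightarrow>\<^sub>E Z. \<forall>v\<in>K. z v \<in> S v} = PiE V (\<lambda>v. if v \<in> K then S v else Z)"
    using assms(4,5) by (fastforce simp: PiE_iff split: if_splits)
  have cZ: "real (card Z) \<noteq> 0" using assms by auto
  have finK: "finite K" using assms(1,4) finite_subset by blast
  have V: "V = K \<union> (V - K)" using assms(4) by auto
  have split: "(\<Prod>v\<in>V. g v) = (\<Prod>v\<in>K. g v) * (\<Prod>v\<in>V - K. g v)" for g :: "'a \<Rightarrow> real"
    using assms(1,4) by (metis mult.commute prod.subset_diff)
  have "real (card (PiE V (\<lambda>v. if v \<in> K then S v else Z))) =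
    (\<Prod>v\<in>V. real (card (if v \<in> K then S v else Z)))"
    using assms(1) by (simp add: card_PiE)
  also have "\<dots> = (\<Prod>v\<in>K. real (card (S v))) * (\<Prod>v\<in>V - K. real (card Z))"
    unfolding split by (intro arg_cong2[of _ _ _ _ "(*)"] prod.cong) auto
  also have "\<dots> = (\<Prod>v\<in>K. real (card Z)) * (\<Prod>v\<in>V - K. real (card Z)) * (\<Prod>v\<in>K. real (card (S v)) / real (card Z))"
    using cZ finK by (simp add: prod_dividef)
  also have "(\<Prod>v\<in>K. real (card Z)) * (\<Prod>v\<in>V - K. real (card Z)) = real (card (V \<rightarrow>\<^sub>E Z))"
    unfolding split[symmetric] using assms(1) by (simp add: card_PiE)
  finally show ?thesis unfolding eq .
qed

lemma exists_ge_average: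
  fixes f :: "'a \<Rightarrow> real"
  assumes "finite S" "S \<noteq> {}" "real (card S) * c \<le> sum f S"
  shows "\<exists>x\<in>S. c \<le> f x"
proof (rule ccontr)
  assume "\<not> ?thesis"
  then have "sum f S < (\<Sum>x\<in>S. c)" using assms by (intro sum_strict_mono) auto
  then show False using assms by simp
qed

lemma sum_card_Collect_swap:
  assumes "finite S" "finite T"
  shows "(\<Sum>x\<in>S. real (card {y \<in> T. R x y})) = (\<Sum>y\<in>T. real (card {x \<in> S. R x y}))"
proof -
  have "(\<Sum>x\<in>S. real (card {y \<in> T. R x y})) = (\<Sum>x\<in>S. \<Sum>y\<in>T. if R x y then 1 else 0)"
    using assms by (intro sum.cong) (auto simp: sum.If_cases Int_def)
  also have "\<dots> = (\<Sum>y\<in>T. \<Sum>x\<in>S. if R x y then 1 else 0)" by (rule sum.swap)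
  also have "\<dots> = (\<Sum>y\<in>T. real (card {x \<in> S. R x y}))"
    using assms by (intro sum.cong) (auto simp: sum.If_cases Int_def)
  finally show ?thesis .
qed

text \<open>Bounds the expected number of edges kept together with \<open>e\<close>, when all of
  them meet in \<open>u\<close>. The three vertices involved are distinct, hence independent, and
  the sizes of the intersections at \<open>u\<close> are summed by double counting. The abstract
  \<open>opp\<close> lets the lemma serve both sides.\<close>

lemma conflict_count_le:
  fixes Z :: "'z set" and V :: "'v set" and opp :: "'e \<Rightarrow> 'v"
  assumes fin: "finite V" "finite Z" "Z \<noteq> {}" "finite F"
    and u: "u \<in> V" "opp e \<in> V" "opp e \<noteq> u"
    and F: "\<And>f. f \<in> F \<Longrightarrow> opp f \<in> V \<and> opp f \<noteq> u \<and> opp f \<noteq> opp e"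
    and Y: "\<And>f. f \<in> insert e F \<Longrightarrow> Y f \<subseteq> Z \<and> card (Y f) = \<beta>"
    and X: "X e \<subseteq> Z" "card (X e) = \<alpha>"
    and n: "\<And>x. x \<in> X e \<Longrightarrow> card {f \<in> F. x \<in> X f} \<le> n"
  shows "(\<Sum>f\<in>F. real (card {z \<in> V \<rightarrow>\<^sub>E Z. z u \<in> X e \<inter> X f \<and> z (opp e) \<in> Y e \<and> z (opp f) \<in> Y f}))
    \<le> real (card (V \<rightarrow>\<^sub>E Z)) * (real \<alpha> * real \<beta> / real (card Z) ^ 2) * (real \<beta> * real n / real (card Z))"
proof -
  let ?C = "real (card (V \<rightarrow>\<^sub>E Z))" and ?N = "real (card Z)"
  have cnt: "real (card {z \<in> V \<rightarrow>\<^sub>E Z. z u \<in> X e \<inter> X f \<and> z (opp e) \<in> Y e \<and> z (opp f) \<in> Y f}) =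
      ?C * (\<beta> ^ 2 / ?N ^ 3) * real (card (X e \<inter> X f))" if f: "f \<in> F" for f
  proof -
    define S where "S = (\<lambda>v. if v = u then X e \<inter> X f else if v = opp e then Y e else Y f)"
    have ne: "opp f \<noteq> u" "opp f \<noteq> opp e" "u \<noteq> opp f" "u \<noteq> opp e" "opp e \<noteq> u" "opp e \<noteq> opp f"
      using F[OF f] u by auto
    have "{z \<in> V \<rightarrow>\<^sub>E Z. z u \<in> X e \<inter> X f \<and> z (opp e) \<in> Y e \<and> z (opp f) \<in> Y f} =
        {z \<in> V \<rightarrow>\<^sub>E Z. \<forall>v\<in>{u, opp e, opp f}. z v \<in> S v}"
      using ne by (auto simp: S_def)
    moreover have "real (card {z \<in> V \<rightarrow>\<^sub>E Z. \<forall>v\<in>{u, opp e, opp f}. z v \<in> S v}) =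
        ?C * (\<Prod>v\<in>{u, opp e, opp f}. real (card (S v)) / ?N)"
    proof (rule card_PiE_constrained)
      show "S v \<subseteq> Z" if "v \<in> {u, opp e, opp f}" for v
        using Y[of e] Y[of f] X f by (auto simp: S_def)
    qed (use fin u F[OF f] in auto)
    moreover have "(\<Prod>v\<in>{u, opp e, opp f}. real (card (S v)) / ?N) =
        real (card (X e \<inter> X f)) / ?N * (\<beta> / ?N * (\<beta> / ?N))"
      using ne Y[of e] Y[of f] f by (simp add: S_def)
    ultimately show ?thesis by (simp add: power2_eq_square power3_eq_cube mult_ac)
  qed
  have finX: "finite (X e)" using X fin finite_subset by blast
  have "(\<Sum>f\<in>F. real (card (X e \<inter> X f))) = (\<Sum>f\<in>F. real (card {x \<in> X e. x \<in> X f}))"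
    by (intro sum.cong) (auto simp: Int_def)
  also have "\<dots> = (\<Sum>x\<in>X e. real (card {f \<in> F. x \<in> X f}))"
    by (rule sum_card_Collect_swap) (use fin finX in auto)
  also have "\<dots> \<le> (\<Sum>x\<in>X e. real n)" using n by (intro sum_mono) simp
  finally have le: "(\<Sum>f\<in>F. real (card (X e \<inter> X f))) \<le> real \<alpha> * real n" using X by simp
  have "(\<Sum>f\<in>F. real (card {z \<in> V \<rightarrow>\<^sub>E Z. z u \<in> X e \<inter> X f \<and> z (opp e) \<in> Y e \<and> z (opp f) \<in> Y f})) =
      ?C * (\<beta> ^ 2 / ?N ^ 3) * (\<Sum>f\<in>F. real (card (X e \<inter> X f)))"
    unfolding sum_distrib_left by (intro sum.cong cnt refl)
  also have "\<dots> \<le> ?C * (\<beta> ^ 2 / ?N ^ 3) * (real \<alpha> * real n)"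
    using le by (intro mult_left_mono) auto
  also have "\<dots> = ?C * (real \<alpha> * real \<beta> / ?N ^ 2) * (real \<beta> * real n / ?N)"
    by (simp add: power2_eq_square power3_eq_cube mult_ac)
  finally show ?thesis .
qed


text \<open>The alteration method: choose \<open>z\<close> at random, then drop every kept pair of
  edge and level that has a kept adjacent edge on the same level. The bound on \<open>w\<close> is
  the probability of being kept, times 1 minus the expected number of conflicts given that. The
  numbers \<open>n\<^sub>A\<close> and \<open>n\<^sub>B\<close> limit how many colours fit one
  vertex value.\<close>

lemma random_thinning:
  fixes A B :: "'v set" and E :: "('v \<times> 'v) set" and L :: "'l set" and Z :: "'z set"
    and X Y :: "'l \<Rightarrow> nat \<Rightarrow> 'z set" and act :: "'l \<Rightarrow> nat \<Rightarrow> bool" and \<alpha> \<beta> n\<^sub>A n\<^sub>B :: "'l \<Rightarrow> nat"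
  assumes bip: "bipartite_graph A B E" and proper: "proper_edge_coloring E \<chi> d"
    and fin: "finite L" "finite Z" "Z \<noteq> {}"
    and X: "\<And>p c. p \<in> L \<Longrightarrow> c \<in> {1..d} \<Longrightarrow> act p c \<Longrightarrow> X p c \<subseteq> Z \<and> card (X p c) = \<alpha> p"
    and Y: "\<And>p c. p \<in> L \<Longrightarrow> c \<in> {1..d} \<Longrightarrow> act p c \<Longrightarrow> Y p c \<subseteq> Z \<and> card (Y p c) = \<beta> p"
    and nA: "\<And>p x. p \<in> L \<Longrightarrow> x \<in> Z \<Longrightarrow> card {c \<in> {1..d}. act p c \<and> x \<in> X p c} \<le> n\<^sub>A p"
    and nB: "\<And>p y. p \<in> L \<Longrightarrow> y \<in> Z \<Longrightarrow> card {c \<in> {1..d}. act p c \<and> y \<in> Y p c} \<le> n\<^sub>B p"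
    and disj: "\<And>p q c. p \<in> L \<Longrightarrow> q \<in> L \<Longrightarrow> p \<noteq> q \<Longrightarrow> act p c \<Longrightarrow> act q c \<Longrightarrow> Y p c \<inter> Y q c = {}"
    and w: "\<And>p. p \<in> L \<Longrightarrow> w \<le> real (\<alpha> p) * real (\<beta> p) / real (card Z) ^ 2 *
        (1 - (real (\<beta> p) * real (n\<^sub>A p) / real (card Z) + real (\<alpha> p) * real (n\<^sub>B p) / real (card Z)))"
  obtains E' lev z where "E' \<subseteq> E"
    and "\<And>e. e \<in> E' \<Longrightarrow> lev e \<in> L \<and> act (lev e) (\<chi> e) \<and> z (fst e) \<in> X (lev e) (\<chi> e) \<and> z (snd e) \<in> Y (lev e) (\<chi> e)"
    and "\<And>e f. e \<in> E' \<Longrightarrow> f \<in> E' \<Longrightarrow> e \<noteq> f \<Longrightarrow> fst e = fst f \<or> snd e = snd f \<Longrightarrow> lev e \<noteq> lev f"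
    and "w * (\<Sum>e\<in>E. real (card {p \<in> L. act p (\<chi> e)})) \<le> real (card E')"
proof -
  define V where "V = A \<union> B"
  define \<Omega> where "\<Omega> = (V \<rightarrow>\<^sub>E Z)"
  define I where "I = (SIGMA e:E. {p \<in> L. act p (\<chi> e)})"
  define R where "R = (\<lambda>z e p. act p (\<chi> e) \<and> z (fst e) \<in> X p (\<chi> e) \<and> z (snd e) \<in> Y p (\<chi> e))"
  define FA where "FA = (\<lambda>e p. {f \<in> E. f \<noteq> e \<and> fst f = fst e \<and> act p (\<chi> f)})"
  define FB where "FB = (\<lambda>e p. {f \<in> E. f \<noteq> e \<and> snd f = snd e \<and> act p (\<chi> f)})"
  define F where "F = (\<lambda>e p. FA e p \<union> FB e p)"
  have fAB: "finite A" "finite B" and EAB: "E \<subseteq> A \<times> B" and AB: "A \<inter> B = {}"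
    using bip by (auto simp: bipartite_graph_def)
  have finE: "finite E" using finite_subset[OF EAB] fAB by blast
  have finV: "finite V" using fAB by (simp add: V_def)
  have fin\<Omega>: "finite \<Omega>" using finV fin by (simp add: \<Omega>_def finite_PiE)
  have ne\<Omega>: "\<Omega> \<noteq> {}" using fin by (simp add: \<Omega>_def PiE_eq_empty_iff)
  have finI: "finite I" using finE fin by (simp add: I_def)
  have finF: "finite (FA e p)" "finite (FB e p)" for e p using finE by (auto simp: FA_def FB_def)
  have col: "\<chi> e \<in> {1..d}" if "e \<in> E" for e using proper that by (auto simp: proper_edge_coloring_def)
  have col_ne: "\<chi> e \<noteq> \<chi> f" if "e \<in> E" "f \<in> E" "e \<noteq> f" "fst e = fst f \<or> snd e = snd f" for e f
    using proper that unfolding proper_edge_coloring_def by blast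
  have ends: "fst e \<in> V" "snd e \<in> V" "fst e \<noteq> snd f" "snd f \<noteq> fst e" if "e \<in> E" "f \<in> E" for e f
    using EAB AB that by (fastforce simp: V_def)+
  let ?C = "real (card \<Omega>)" and ?N = "real (card Z)"
  define wt where "wt p = real (\<alpha> p) * real (\<beta> p) / ?N ^ 2" for p
  have kept: "real (card {z \<in> \<Omega>. R z e p}) = ?C * wt p" if I: "(e, p) \<in> I" for e p
  proof -
    have e: "e \<in> E" "p \<in> L" "act p (\<chi> e)" using I by (auto simp: I_def)
    define S where "S = (\<lambda>v. if v = fst e then X p (\<chi> e) else Y p (\<chi> e))"
    have "{z \<in> \<Omega>. R z e p} = {z \<in> V \<rightarrow>\<^sub>E Z. \<forall>v\<in>{fst e, snd e}. z v \<in> S v}"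
      using ends[OF e(1) e(1)] e by (auto simp: \<Omega>_def R_def S_def)
    moreover have "real (card {z \<in> V \<rightarrow>\<^sub>E Z. \<forall>v\<in>{fst e, snd e}. z v \<in> S v}) =
        ?C * (\<Prod>v\<in>{fst e, snd e}. real (card (S v)) / ?N)"
      unfolding \<Omega>_def
    proof (rule card_PiE_constrained)
      show "S v \<subseteq> Z" if "v \<in> {fst e, snd e}" for v
        using X[OF e(2) col[OF e(1)] e(3)] Y[OF e(2) col[OF e(1)] e(3)] by (auto simp: S_def)
    qed (use finV fin ends[OF e(1) e(1)] in auto)
    moreover have "(\<Prod>v\<in>{fst e, snd e}. real (card (S v)) / ?N) = wt p"
      using ends[OF e(1) e(1)] X[OF e(2) col[OF e(1)] e(3)] Y[OF e(2) col[OF e(1)] e(3)]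
      by (simp add: S_def wt_def power2_eq_square)
    ultimately show ?thesis by simp
  qed
  have lost: "(\<Sum>f\<in>F e p. real (card {z \<in> \<Omega>. R z e p \<and> R z f p})) \<le>
      ?C * wt p * (real (\<beta> p) * real (n\<^sub>A p) / ?N + real (\<alpha> p) * real (n\<^sub>B p) / ?N)" if I: "(e, p) \<in> I" for e p
  proof -
    have e: "e \<in> E" "p \<in> L" "act p (\<chi> e)" using I by (auto simp: I_def)
    \<comment> \<open>Edges at one vertex have different colours, so it suffices to count
      colours.\<close>
    have inj: "card {f \<in> G. Q (\<chi> f)} \<le> card {c \<in> {1..d}. act p c \<and> Q c}"
      if "G = FA e p \<or> G = FB e p" for G Q
    proof (rule card_inj_on_le[of \<chi>])
      show "inj_on \<chi> {f \<in> G. Q (\<chi> f)}"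
        using that col_ne unfolding inj_on_def FA_def FB_def by (smt (verit) mem_Collect_eq)
      show "\<chi> ` {f \<in> G. Q (\<chi> f)} \<subseteq> {c \<in> {1..d}. act p c \<and> Q c}"
        using that col by (fastforce simp: FA_def FB_def)
    qed simp
    have "(\<Sum>f\<in>FA e p. real (card {z \<in> \<Omega>. R z e p \<and> R z f p})) =
      (\<Sum>f\<in>FA e p. real (card {z \<in> V \<rightarrow>\<^sub>E Z. z (fst e) \<in> X p (\<chi> e) \<inter> X p (\<chi> f) \<and>
          z (snd e) \<in> Y p (\<chi> e) \<and> z (snd f) \<in> Y p (\<chi> f)}))"
      using e by (intro sum.cong refl arg_cong[where f = "\<lambda>S. real (card S)"])
        (auto simp: R_def FA_def \<Omega>_def)
    also have "\<dots> \<le> real (card (V \<rightarrow>\<^sub>E Z)) * (real (\<alpha> p) * real (\<beta> p) / ?N ^ 2) * (real (\<beta> p) * real (n\<^sub>A p) / ?N)"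
    proof (rule conflict_count_le[where X = "\<lambda>f. X p (\<chi> f)" and Y = "\<lambda>f. Y p (\<chi> f)" and opp = snd and e = e and u = "fst e"])
      show "snd f \<in> V \<and> snd f \<noteq> fst e \<and> snd f \<noteq> snd e" if "f \<in> FA e p" for f
        using that ends[of f f] ends[of e f] e by (auto simp: FA_def prod_eq_iff)
      show "Y p (\<chi> f) \<subseteq> Z \<and> card (Y p (\<chi> f)) = \<beta> p" if "f \<in> insert e (FA e p)" for f
        using that Y[of p "\<chi> f"] col[of f] e by (auto simp: FA_def)
      show "card {f \<in> FA e p. x \<in> X p (\<chi> f)} \<le> n\<^sub>A p" if "x \<in> X p (\<chi> e)" for x
        using inj[of "FA e p" "\<lambda>c. x \<in> X p c"] nA[of p x] X[of p "\<chi> e"] col[of e] e that by fastforce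
    qed (use finV fin finF ends[of e e] e X[of p "\<chi> e"] col[of e] in auto)
    finally have lA: "(\<Sum>f\<in>FA e p. real (card {z \<in> \<Omega>. R z e p \<and> R z f p})) \<le> ?C * wt p * (real (\<beta> p) * real (n\<^sub>A p) / ?N)"
      by (simp add: \<Omega>_def wt_def)
    have "(\<Sum>f\<in>FB e p. real (card {z \<in> \<Omega>. R z e p \<and> R z f p})) =
      (\<Sum>f\<in>FB e p. real (card {z \<in> V \<rightarrow>\<^sub>E Z. z (snd e) \<in> Y p (\<chi> e) \<inter> Y p (\<chi> f) \<and>
          z (fst e) \<in> X p (\<chi> e) \<and> z (fst f) \<in> X p (\<chi> f)}))"
      using e by (intro sum.cong refl arg_cong[where f = "\<lambda>S. real (card S)"])
        (auto simp: R_def FB_def \<Omega>_def)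
    also have "\<dots> \<le> real (card (V \<rightarrow>\<^sub>E Z)) * (real (\<beta> p) * real (\<alpha> p) / ?N ^ 2) * (real (\<alpha> p) * real (n\<^sub>B p) / ?N)"
    proof (rule conflict_count_le[where X = "\<lambda>f. Y p (\<chi> f)" and Y = "\<lambda>f. X p (\<chi> f)" and opp = fst and e = e and u = "snd e"])
      show "fst f \<in> V \<and> fst f \<noteq> snd e \<and> fst f \<noteq> fst e" if "f \<in> FB e p" for f
        using that ends[of f f] ends[of f e] e by (auto simp: FB_def prod_eq_iff)
      show "X p (\<chi> f) \<subseteq> Z \<and> card (X p (\<chi> f)) = \<alpha> p" if "f \<in> insert e (FB e p)" for f
        using that X[of p "\<chi> f"] col[of f] e by (auto simp: FB_def)
      show "card {f \<in> FB e p. x \<in> Y p (\<chi> f)} \<le> n\<^sub>B p" if "x \<in> Y p (\<chi> e)" for x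
        using inj[of "FB e p" "\<lambda>c. x \<in> Y p c"] nB[of p x] Y[of p "\<chi> e"] col[of e] e that by fastforce
    qed (use finV fin finF ends[of e e] e Y[of p "\<chi> e"] col[of e] in auto)
    finally have lB: "(\<Sum>f\<in>FB e p. real (card {z \<in> \<Omega>. R z e p \<and> R z f p})) \<le> ?C * wt p * (real (\<alpha> p) * real (n\<^sub>B p) / ?N)"
      by (simp add: \<Omega>_def wt_def mult_ac)
    have "FA e p \<inter> FB e p = {}" by (auto simp: FA_def FB_def)
    then have "(\<Sum>f\<in>F e p. real (card {z \<in> \<Omega>. R z e p \<and> R z f p})) =
        (\<Sum>f\<in>FA e p. real (card {z \<in> \<Omega>. R z e p \<and> R z f p})) + (\<Sum>f\<in>FB e p. real (card {z \<in> \<Omega>. R z e p \<and> R z f p}))"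
      unfolding F_def using finF by (intro sum.union_disjoint) auto
    then show ?thesis using lA lB by (simp add: distrib_left)
  qed
  \<comment> \<open>Subtracting all conflicts, and not just the pairs that have one, gives a
    quantity whose average is computable and which only underestimates what survives.\<close>
  define gain where "gain z = real (card {(e, p) \<in> I. R z e p}) -
      (\<Sum>(e, p)\<in>I. real (card {f \<in> F e p. R z e p \<and> R z f p}))" for z
  have cardI: "real (card I) = (\<Sum>e\<in>E. real (card {p \<in> L. act p (\<chi> e)}))"
    unfolding I_def using finE fin by (simp add: card_SigmaI)
  have "(\<Sum>z\<in>\<Omega>. gain z) = (\<Sum>z\<in>\<Omega>. real (card {i \<in> I. R z (fst i) (snd i)})) -
      (\<Sum>z\<in>\<Omega>. \<Sum>i\<in>I. real (card {f \<in> F (fst i) (snd i). R z (fst i) (snd i) \<and> R z f (snd i)}))"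
    unfolding gain_def sum_subtractf by (simp add: case_prod_beta')
  also have "(\<Sum>z\<in>\<Omega>. real (card {i \<in> I. R z (fst i) (snd i)})) = (\<Sum>i\<in>I. real (card {z \<in> \<Omega>. R z (fst i) (snd i)}))"
    by (rule sum_card_Collect_swap[OF fin\<Omega> finI])
  also have "(\<Sum>z\<in>\<Omega>. \<Sum>i\<in>I. real (card {f \<in> F (fst i) (snd i). R z (fst i) (snd i) \<and> R z f (snd i)})) =
      (\<Sum>i\<in>I. \<Sum>f\<in>F (fst i) (snd i). real (card {z \<in> \<Omega>. R z (fst i) (snd i) \<and> R z f (snd i)}))"
    by (subst sum.swap, intro sum.cong refl sum_card_Collect_swap[OF fin\<Omega>]) (use finF in \<open>simp add: F_def\<close>)
  also have "(\<Sum>i\<in>I. real (card {z \<in> \<Omega>. R z (fst i) (snd i)})) -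
      (\<Sum>i\<in>I. \<Sum>f\<in>F (fst i) (snd i). real (card {z \<in> \<Omega>. R z (fst i) (snd i) \<and> R z f (snd i)})) \<ge> (\<Sum>i\<in>I. ?C * w)"
    unfolding sum_subtractf[symmetric]
  proof (rule sum_mono)
    fix i assume i: "i \<in> I"
    then have ip: "(fst i, snd i) \<in> I" by simp
    have "snd i \<in> L" using i by (auto simp: I_def)
    then have "?C * w \<le> ?C * (wt (snd i) * (1 - (real (\<beta> (snd i)) * real (n\<^sub>A (snd i)) / ?N + real (\<alpha> (snd i)) * real (n\<^sub>B (snd i)) / ?N)))"
      unfolding wt_def by (intro mult_left_mono w) auto
    then show "?C * w \<le> real (card {z \<in> \<Omega>. R z (fst i) (snd i)}) -
        (\<Sum>f\<in>F (fst i) (snd i). real (card {z \<in> \<Omega>. R z (fst i) (snd i) \<and> R z f (snd i)}))"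
      using kept[OF ip] lost[OF ip] by (simp add: algebra_simps)
  qed
  finally have "real (card \<Omega>) * (w * real (card I)) \<le> sum gain \<Omega>" by (simp add: mult_ac)
  then obtain z where z: "z \<in> \<Omega>" "w * real (card I) \<le> gain z"
    using exists_ge_average[OF fin\<Omega> ne\<Omega>] by blast
  define K where "K = {(e, p) \<in> I. R z e p}"
  define M where "M = {(e, p) \<in> I. R z e p \<and> (\<exists>f\<in>F e p. R z f p)}"
  define E' where "E' = fst ` (K - M)"
  define lev where "lev e = (THE p. (e, p) \<in> K)" for e
  have finK: "finite K" "finite M" "M \<subseteq> K" using finI by (auto simp: K_def M_def intro: rev_finite_subset)
  \<comment> \<open>By \<open>disj\<close> an edge is kept on at most one level, so
    \<open>lev\<close> is well defined and no edge is counted twice.\<close>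
  have uniq: "p = q" if "(e, p) \<in> K" "(e, q) \<in> K" for e p q
    using that disj[of p q "\<chi> e"] by (auto simp: K_def I_def R_def)
  have lev: "lev e = p" if "(e, p) \<in> K" for e p
    unfolding lev_def using that uniq by (intro the_equality) auto
  have inE': "(e, lev e) \<in> K - M" if "e \<in> E'" for e
    using that lev by (auto simp: E'_def)
  have "real (card M) \<le> (\<Sum>(e, p)\<in>M. real (card {f \<in> F e p. R z e p \<and> R z f p}))"
  proof -
    have "(1::real) \<le> (case i of (e, p) \<Rightarrow> real (card {f \<in> F e p. R z e p \<and> R z f p}))" if "i \<in> M" for i
    proof -
      obtain e p where i: "i = (e, p)" by (cases i)
      have "{f \<in> F e p. R z e p \<and> R z f p} \<noteq> {}" using that by (auto simp: M_def i)
      moreover have "finite {f \<in> F e p. R z e p \<and> R z f p}" using finF by (simp add: F_def)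
      ultimately show ?thesis by (simp add: i Suc_le_eq card_gt_0_iff)
    qed
    then have "(\<Sum>i\<in>M. 1) \<le> (\<Sum>(e, p)\<in>M. real (card {f \<in> F e p. R z e p \<and> R z f p}))" by (intro sum_mono)
    then show ?thesis by simp
  qed
  also have "\<dots> \<le> (\<Sum>(e, p)\<in>I. real (card {f \<in> F e p. R z e p \<and> R z f p}))"
    using finI by (intro sum_mono2) (auto simp: M_def)
  finally have "gain z \<le> real (card K) - real (card M)" unfolding gain_def K_def by simp
  also have "\<dots> = real (card (K - M))" using finK by (simp add: card_Diff_subset card_mono of_nat_diff)
  also have "card (K - M) = card E'"
    unfolding E'_def by (rule card_image[symmetric]) (use uniq in \<open>auto simp: inj_on_def\<close>)
  finally have size: "w * real (card I) \<le> real (card E')" using z by simp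
  show thesis
  proof (rule that[of E' lev z])
    show "E' \<subseteq> E" by (auto simp: E'_def K_def I_def)
    show "lev e \<in> L \<and> act (lev e) (\<chi> e) \<and> z (fst e) \<in> X (lev e) (\<chi> e) \<and> z (snd e) \<in> Y (lev e) (\<chi> e)" if "e \<in> E'" for e
      using inE'[OF that] by (auto simp: K_def I_def R_def)
    show "lev e \<noteq> lev f" if ef: "e \<in> E'" "f \<in> E'" "e \<noteq> f" "fst e = fst f \<or> snd e = snd f" for e f
    proof
      assume eq: "lev e = lev f"
      have "f \<in> F e (lev e)"
        using inE'[OF ef(2)] ef eq by (auto simp: F_def FA_def FB_def K_def I_def)
      then have "(e, lev e) \<in> M" using inE'[OF ef(1)] inE'[OF ef(2)] eq by (auto simp: M_def K_def)
      then show False using inE'[OF ef(1)] by simp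
    qed
    show "w * (\<Sum>e\<in>E. real (card {p \<in> L. act p (\<chi> e)})) \<le> real (card E')" using size cardI by simp
  qed
qed

subsection \<open>Digits and random shifts\<close>

text \<open>Clearing the digit with weight \<open>b ^ p\<close> moves at most \<open>b\<close> elements of \<open>S\<close> onto the same one.\<close>

lemma card_zero_digit:
  fixes S :: "nat set"
  assumes "finite S" "b > 0"
    and closed: "\<And>t. t \<in> S \<Longrightarrow> t - t div b ^ p mod b * b ^ p \<in> S"
  shows "card S \<le> b * card {t \<in> S. t div b ^ p mod b = 0}"
proof -
  let ?S0 = "{t \<in> S. t div b ^ p mod b = 0}"
  have le: "t div b ^ p mod b * b ^ p \<le> t" for t
    by (meson le_trans div_times_less_eq_dividend mod_less_eq_dividend mult_le_mono1)
  have zero: "(t - t div b ^ p mod b * b ^ p) div b ^ p mod b = 0" for t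
  proof -
    define x where "x = t div b ^ p"
    define y r u where "y = x div b" and "r = x mod b" and "u = t mod b ^ p"
    have "t = x * b ^ p + u" by (simp only: x_def u_def div_mult_mod_eq)
    moreover have "x = y * b + r" by (simp only: y_def r_def div_mult_mod_eq)
    ultimately have "t = u + b ^ p * (y * b) + r * b ^ p" by (simp add: algebra_simps)
    then have "t - r * b ^ p = u + b ^ p * (y * b)" by simp
    then have "t - x mod b * b ^ p = t mod b ^ p + b ^ p * (x div b * b)"
      unfolding y_def r_def u_def .
    then have "(t - x mod b * b ^ p) div b ^ p = x div b * b"
      using assms(2) by simp
    then show ?thesis by (simp add: x_def)
  qed
  have "S \<subseteq> (\<lambda>(i, t). t + i * b ^ p) ` ({..<b} \<times> ?S0)"
  proof
    fix t assume t: "t \<in> S"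
    have "(t div b ^ p mod b, t - t div b ^ p mod b * b ^ p) \<in> {..<b} \<times> ?S0"
      using assms(2) closed[OF t] zero by simp
    moreover have "t = (\<lambda>(i, t). t + i * b ^ p) (t div b ^ p mod b, t - t div b ^ p mod b * b ^ p)"
      using le[of t] by simp
    ultimately show "t \<in> (\<lambda>(i, t). t + i * b ^ p) ` ({..<b} \<times> ?S0)" by (rule rev_image_eqI)
  qed
  then have "card S \<le> card ({..<b} \<times> ?S0)"
    using assms(1) by (intro surj_card_le) auto
  then show ?thesis by (simp add: card_cartesian_product)
qed

lemma card_one_zero_digit:
  assumes "b > 0"
  shows "b ^ m \<le> b * card {t. t < b ^ m \<and> t div b ^ p mod b = (0::nat)}"
  using card_zero_digit[of "{..<b ^ m}" b p] assms by (auto intro: le_less_trans[OF diff_le_self])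

text \<open>The lower digit is cleared second. This leaves \<open>t div b ^ p\<close> unchanged, so
  the digit at \<open>p\<close> stays zero and \<open>card_zero_digit\<close> applies inside the
  first set.\<close>

lemma card_two_zero_digits:
  assumes "b > 0" "q < p"
  shows "b ^ m \<le> b * b * card {t. t < b ^ m \<and> t div b ^ p mod b = (0::nat) \<and> t div b ^ q mod b = 0}"
proof -
  let ?S = "{t. t < b ^ m \<and> t div b ^ p mod b = 0}"
  have high: "(t - t div b ^ q mod b * b ^ q) div b ^ p = t div b ^ p" for t
  proof -
    define x where "x = t div b ^ q"
    define y r u where "y = x div b" and "r = x mod b" and "u = t mod b ^ q"
    have "t = x * b ^ q + u" by (simp only: x_def u_def div_mult_mod_eq)
    moreover have "x = y * b + r" by (simp only: y_def r_def div_mult_mod_eq)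
    ultimately have "t = u + b ^ Suc q * y + r * b ^ q" by (simp add: algebra_simps)
    then have "t - r * b ^ q = u + b ^ Suc q * y" by simp
    then have "t - x mod b * b ^ q = t mod b ^ q + b ^ Suc q * (x div b)"
      unfolding y_def r_def u_def .
    moreover have "t mod b ^ q < b ^ Suc q"
    proof -
      have "t mod b ^ q < b ^ q" using assms(1) by simp
      also have "b ^ q \<le> b ^ Suc q" using assms(1) by simp
      finally show ?thesis .
    qed
    moreover have nz: "b ^ Suc q \<noteq> 0" using assms(1) by simp
    ultimately have "(t - x mod b * b ^ q) div b ^ Suc q = x div b"
      by (simp add: div_mult_self2[OF nz] del: power_Suc)
    also have "x div b = t div b ^ Suc q"
      unfolding x_def by (simp only: power_Suc2 div_mult2_eq)
    finally have 1: "(t - t div b ^ q mod b * b ^ q) div b ^ Suc q = t div b ^ Suc q"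
      by (simp only: x_def)
    have "b ^ p = b ^ Suc q * b ^ (p - Suc q)"
      using power_add[of b "Suc q" "p - Suc q"] assms(2) by (simp del: power_Suc add_Suc)
    then show ?thesis using 1 by (simp only: div_mult2_eq)
  qed
  have "card ?S \<le> b * card {t \<in> ?S. t div b ^ q mod b = 0}"
  proof (rule card_zero_digit)
    fix t assume t: "t \<in> ?S"
    have "t - t div b ^ q mod b * b ^ q \<le> t" by (rule diff_le_self)
    also have "t < b ^ m" using t by simp
    finally show "t - t div b ^ q mod b * b ^ q \<in> ?S" using t unfolding mem_Collect_eq high by blast
  qed (use assms(1) in auto)
  then have "b * card ?S \<le> b * (b * card {t \<in> ?S. t div b ^ q mod b = 0})" by (rule mult_le_mono2)
  also have "{t \<in> ?S. t div b ^ q mod b = 0} = {t. t < b ^ m \<and> t div b ^ p mod b = 0 \<and> t div b ^ q mod b = 0}"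
    by auto
  finally show ?thesis
    using card_one_zero_digit[OF assms(1), of m p] unfolding mult.assoc by (rule order_trans[rotated])
qed

text \<open>Adding \<open>c\<close> permutes the residues modulo \<open>M\<close>.\<close>

lemma card_shift_mod:
  fixes M :: nat
  shows "card {s. s < M \<and> Q ((c + s) mod M)} = card {t. t < M \<and> Q t}"
proof (cases "M = 0")
  case False
  let ?g = "\<lambda>s. (c + s) mod M"
  have inj: "inj_on ?g {..<M}"
  proof (rule inj_onI)
    fix x y assume "x \<in> {..<M}" "y \<in> {..<M}" "(c + x) mod M = (c + y) mod M"
    then obtain q1 q2 where "c + x + M * q1 = c + y + M * q2" unfolding nat_mod_eq_iff by blast
    then have "x + M * q1 = y + M * q2" by simp
    then have "x mod M = y mod M" unfolding nat_mod_eq_iff by blast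
    then show "x = y" using \<open>x \<in> _\<close> \<open>y \<in> _\<close> by simp
  qed
  have "?g ` {..<M} \<subseteq> {..<M}" using False by auto
  then have im: "?g ` {..<M} = {..<M}" using endo_inj_surj[OF finite_lessThan _ inj] by blast
  have "?g ` {s. s < M \<and> Q (?g s)} = {t. t < M \<and> Q t}"
  proof (intro equalityI subsetI)
    fix t assume t: "t \<in> {t. t < M \<and> Q t}"
    then have "t \<in> ?g ` {..<M}" unfolding im by simp
    then obtain s where "s < M" "t = ?g s" by blast
    then show "t \<in> ?g ` {s. s < M \<and> Q (?g s)}" using t by blast
  qed (use False in auto)
  moreover have "inj_on ?g {s. s < M \<and> Q (?g s)}" using inj by (rule inj_on_subset) auto
  ultimately show ?thesis using card_image[of ?g "{s. s < M \<and> Q (?g s)}"] by simp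
qed simp

lemma digit_mod_power:
  fixes t :: nat
  assumes "p < m"
  shows "(t mod b ^ m) div b ^ p mod b = t div b ^ p mod b"
proof -
  have m: "b ^ m = b ^ p * b ^ (m - p)" using assms by (simp flip: power_add)
  have "(t mod b ^ m) div b ^ p = (t div b ^ p) mod b ^ (m - p)"
  proof (cases "b = 0")
    case False
    then show ?thesis unfolding m by (simp add: mod_mult2_eq)
  qed (use assms in \<open>auto simp: zero_power\<close>)
  moreover have "b dvd b ^ (m - p)" using assms by simp
  ultimately show ?thesis by (simp add: mod_mod_cancel)
qed

text \<open>The given colours might all lack the required zero digits. Under a uniformly random
  shift the residue of each colour becomes uniform, so every pair of edge and level is active with
  probability at least \<open>1 / r\<close>, and some shift attains the average.\<close>

lemma exists_good_shift:
  fixes Q :: "nat \<Rightarrow> nat \<Rightarrow> bool" and E :: "'e set" and \<chi> :: "'e \<Rightarrow> nat"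
  assumes "finite E" "finite L" "M > 0"
    and period: "\<And>p t. p \<in> L \<Longrightarrow> Q p (t mod M) = Q p t"
    and dens: "\<And>p. p \<in> L \<Longrightarrow> M \<le> r * card {t. t < M \<and> Q p t}"
  shows "\<exists>s<M. real (card E) * real (card L) \<le> real r * (\<Sum>e\<in>E. real (card {p \<in> L. Q p (\<chi> e + s)}))"
proof -
  have "real M * (real (card E) * real (card L)) = (\<Sum>e\<in>E. \<Sum>p\<in>L. real M)" by simp
  also have "\<dots> \<le> (\<Sum>e\<in>E. \<Sum>p\<in>L. real r * real (card {s \<in> {..<M}. Q p (\<chi> e + s)}))"
  proof (intro sum_mono)
    fix e p assume "p \<in> L"
    then have "card {s \<in> {..<M}. Q p (\<chi> e + s)} = card {t. t < M \<and> Q p t}"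
      using card_shift_mod[of M "Q p" "\<chi> e"] period by simp
    then show "real M \<le> real r * real (card {s \<in> {..<M}. Q p (\<chi> e + s)})"
      using dens[OF \<open>p \<in> L\<close>] by (simp flip: of_nat_mult)
  qed
  also have "\<dots> = real r * (\<Sum>e\<in>E. \<Sum>p\<in>L. real (card {s \<in> {..<M}. Q p (\<chi> e + s)}))"
    by (simp add: sum_distrib_left)
  also have "\<dots> = real r * (\<Sum>e\<in>E. \<Sum>s<M. real (card {p \<in> L. Q p (\<chi> e + s)}))"
    using sum_card_Collect_swap[OF assms(2), of "{..<M}"] by simp
  also have "\<dots> = (\<Sum>s<M. real r * (\<Sum>e\<in>E. real (card {p \<in> L. Q p (\<chi> e + s)})))"
    by (subst sum.swap) (simp add: sum_distrib_left)
  finally show ?thesis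
    using exists_ge_average[of "{..<M}" "real (card E) * real (card L)"] assms(3) by auto
qed

lemma card_div_eq:
  fixes g k :: nat
  assumes "k > 0"
  shows "{t. t div k = g} = {g * k..<g * k + k}" "card {t. t div k = g} = k"
proof -
  have "t div k = g \<longleftrightarrow> g * k \<le> t \<and> t < g * k + k" for t
  proof
    assume g: "t div k = g"
    have "t div k * k \<le> t" "t < t div k * k + k"
      using div_times_less_eq_dividend[of t k] dividend_less_div_times[OF assms, of t] by (simp_all only: add.commute)
    then show "g * k \<le> t \<and> t < g * k + k" unfolding g by blast
  next
    assume "g * k \<le> t \<and> t < g * k + k"
    then show "t div k = g" by (intro div_nat_eqI) (simp_all add: mult.commute)
  qed
  then show "{t. t div k = g} = {g * k..<g * k + k}"
    by (simp only: set_eq_iff mem_Collect_eq atLeastLessThan_iff simp_thms)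
  then show "card {t. t div k = g} = k" by simp
qed

text \<open>A block of length \<open>k * j\<close> consists of \<open>j\<close> full periods modulo
  \<open>k\<close>.\<close>

lemma card_div_mod_eq:
  fixes g k j a :: nat
  assumes "j > 0" "k > 0" "a < k"
  shows "card {t. t div (k * j) = g \<and> t mod k = a} = j"
proof -
  have "bij_betw (\<lambda>i. a + k * (g * j + i)) {..<j} {t. t div (k * j) = g \<and> t mod k = a}"
  proof (rule bij_betwI')
    fix x y assume "x \<in> {..<j}" "y \<in> {..<j}"
    then show "(a + k * (g * j + x) = a + k * (g * j + y)) = (x = y)" using assms by auto
  next
    fix x assume "x \<in> {..<j}"
    then show "a + k * (g * j + x) \<in> {t. t div (k * j) = g \<and> t mod k = a}"
      using assms by (simp add: div_mult2_eq)
  next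
    fix t assume "t \<in> {t. t div (k * j) = g \<and> t mod k = a}"
    then have t: "t div k div j = g" "t mod k = a" by (auto simp: div_mult2_eq)
    have "t = a + k * (t div k)" using t(2) by (metis add.commute mult_div_mod_eq)
    also have "t div k = g * j + t div k mod j" using t(1) by (metis div_mult_mod_eq)
    finally show "\<exists>x\<in>{..<j}. t = a + k * (g * j + x)" using assms by (metis lessThan_iff mod_less_divisor)
  qed
  then show ?thesis using bij_betw_same_card by fastforce
qed

subsection \<open>The two thinning steps\<close>

text \<open>Adding \<open>i < b\<close> to a zero digit causes no carry, so all higher positions
  agree. This is why a colour must have a zero digit to be active.\<close>

lemma div_power_eq_of_low_digit:
  fixes t y b i :: nat
  assumes "t div b ^ p mod b = 0" "y div b ^ p = t div b ^ p + i" "i < b" "p < P"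
  shows "y div b ^ P = t div b ^ P"
proof -
  obtain g where g: "t div b ^ p = b * g" using assms(1) by (auto elim: dvdE)
  have P: "b ^ P = b ^ p * b * b ^ (P - Suc p)"
    using power_add[of b "Suc p" "P - Suc p"] assms(4) by (simp add: power_Suc2 del: power_Suc add_Suc)
  have "y div b ^ p div b = g" unfolding assms(2) g using assms(3) by simp
  moreover have "t div b ^ p div b = g" unfolding g using assms(3) by simp
  ultimately show ?thesis unfolding P div_mult2_eq by simp
qed

text \<open>As \<open>K\<close> divides \<open>N\<close>, no block of length \<open>K\<close>
  straddles \<open>N\<close>.\<close>

lemma less_of_div_eq:
  fixes x t K N :: nat
  assumes "x div K = t div K" "K dvd N" "t < N"
  shows "x < N"
proof -
  have K: "0 < K" using assms(2,3) by (cases K) auto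
  obtain n where n: "N = n * K" using assms(2) by (metis dvdE mult.commute)
  have "t div K < n" using assms(3) K unfolding n by (simp only: div_less_iff_less_mult)
  then show ?thesis using K unfolding n assms(1)[symmetric] by (simp only: div_less_iff_less_mult)
qed

text \<open>The right-hand side equals \<open>(T - 2) / (T ^ 3 * M)\<close>. Since
  \<open>T * M \<le> 2 * d\<close>, it remains to check \<open>T ^ 2 \<le> 10 * (T - 2)\<close>,
  which holds for \<open>T\<close> from 4 to 7; hence the constant 20.\<close>

lemma thinning_weight:
  fixes d T M :: nat
  assumes "4 \<le> T" "T \<le> 7" "T * M \<le> 2 * d" "M > 0"
  shows "1 / (20 * real d) \<le> real M / real (T * M) ^ 2 * (1 - (real M / real (T * M) + real M / real (T * M)))"
proof -
  have d: "real T * real M \<le> 2 * real d" "0 < real d"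
    using assms by (metis of_nat_le_iff of_nat_mult of_nat_numeral) (use assms in \<open>cases d; auto\<close>)
  have "T = 4 \<or> T = 5 \<or> T = 6 \<or> T = 7" using assms by linarith
  then have key: "10 * (real T - 2) \<ge> real T ^ 2" by auto
  have "1 / (20 * real d) \<le> 1 / (10 * (real T * real M))"
    using d assms(1,4) by (intro frac_le) (simp_all add: mult.commute[of "real M"])
  also have "\<dots> \<le> (real T - 2) / (real T ^ 3 * real M)"
    using key assms by (simp add: field_simps power2_eq_square power3_eq_cube)
  also have "\<dots> = real M / real (T * M) ^ 2 * (1 - (real M / real (T * M) + real M / real (T * M)))"
    using assms by (simp add: field_simps power2_eq_square power3_eq_cube)
  finally show ?thesis .
qed

text \<open>The common frame of both steps, with \<open>M\<close> of order \<open>d\<close>. Because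
  \<open>\<alpha> p * \<beta> p = M\<close> on every level, both conflict terms are
  \<open>M / N\<close> and all levels have the same survival rate. The size \<open>N\<close> is a
  multiple of \<open>M\<close>, so that whole digit blocks fit into \<open>{..<N}\<close>.\<close>

lemma shifted_thinning:
  fixes E :: "('v \<times> 'v) set" and X Y :: "nat \<Rightarrow> nat \<Rightarrow> nat set" and act :: "nat \<Rightarrow> nat \<Rightarrow> bool"
  assumes bip: "bipartite_graph A B E" and proper: "proper_edge_coloring E \<chi> d"
    and M: "M > 0" "2 * M \<le> d" "d < 6 * M" and L: "finite L" and N: "N = (d div M + 2) * M"
    and period: "\<And>p t. p \<in> L \<Longrightarrow> act p (t mod M) = act p t"
    and dens: "\<And>p. p \<in> L \<Longrightarrow> M \<le> r * card {t. t < M \<and> act p t}"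
    and X: "\<And>p t. p \<in> L \<Longrightarrow> t < N \<Longrightarrow> act p t \<Longrightarrow> X p t \<subseteq> {..<N} \<and> card (X p t) = \<alpha> p"
    and Y: "\<And>p t. p \<in> L \<Longrightarrow> t < N \<Longrightarrow> act p t \<Longrightarrow> Y p t \<subseteq> {..<N} \<and> card (Y p t) = \<beta> p"
    and nA: "\<And>p x. p \<in> L \<Longrightarrow> card {t. t < N \<and> act p t \<and> x \<in> X p t} \<le> \<alpha> p"
    and nB: "\<And>p y. p \<in> L \<Longrightarrow> card {t. t < N \<and> act p t \<and> y \<in> Y p t} \<le> \<beta> p"
    and prod: "\<And>p. p \<in> L \<Longrightarrow> \<alpha> p * \<beta> p = M"
    and disj: "\<And>p q t. p \<in> L \<Longrightarrow> q \<in> L \<Longrightarrow> p < q \<Longrightarrow> act p t \<Longrightarrow> act q t \<Longrightarrow> Y p t \<inter> Y q t = {}"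
  obtains E' lev z s where "E' \<subseteq> E"
    and "\<And>e. e \<in> E' \<Longrightarrow> lev e \<in> L \<and> act (lev e) (\<chi> e + s) \<and>
        z (fst e) \<in> X (lev e) (\<chi> e + s) \<and> z (snd e) \<in> Y (lev e) (\<chi> e + s)"
    and "\<And>e f. e \<in> E' \<Longrightarrow> f \<in> E' \<Longrightarrow> e \<noteq> f \<Longrightarrow> fst e = fst f \<or> snd e = snd f \<Longrightarrow> lev e \<noteq> lev f"
    and "real (card E) * real (card L) \<le> 20 * real r * real d * real (card E')"
proof -
  have finE: "finite E" using bip unfolding bipartite_graph_def by (meson finite_SigmaI finite_subset)
  obtain s where s: "s < M"
    and good: "real (card E) * real (card L) \<le> real r * (\<Sum>e\<in>E. real (card {p \<in> L. act p (\<chi> e + s)}))"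
    using exists_good_shift[where Q = act and r = r, OF finE L M(1) period dens] by blast
  \<comment> \<open>The two extra multiples of \<open>M\<close> in \<open>N\<close> absorb the
    remainder of \<open>d\<close> modulo \<open>M\<close> and the shift
    \<open>s < M\<close>.\<close>
  define q where "q = d div M * M"
  have q: "q \<le> d" "d < q + M"
    using dividend_less_div_times[OF M(1), of d] by (simp_all add: q_def add.commute)
  have "N = q + 2 * M" by (simp add: N q_def)
  then have dM: "d + M < N" "N \<le> 2 * d" using q M(2) by simp_all
  have T: "4 \<le> d div M + 2" "d div M + 2 \<le> 7"
  proof -
    have "2 \<le> d div M" using M(1,2) by (simp only: less_eq_div_iff_mult_less_eq)
    moreover have "d div M < 6" using M(1,3) by (simp only: div_less_iff_less_mult)
    ultimately show "4 \<le> d div M + 2" "d div M + 2 \<le> 7" by simp_all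
  qed
  have cs: "c + s < N" if "c \<in> {1..d}" for c using that s dM by auto
  have shift: "card {c \<in> {1..d}. Q (c + s)} \<le> card {t. t < N \<and> Q t}" for Q
  proof (rule card_inj_on_le[of "\<lambda>c. c + s"])
    show "(\<lambda>c. c + s) ` {c \<in> {1..d}. Q (c + s)} \<subseteq> {t. t < N \<and> Q t}" using cs by auto
  qed auto
  have cardN: "card {..<N} = (d div M + 2) * M" by (simp add: N)
  show thesis
  proof (rule random_thinning[OF bip proper L, where Z = "{..<N}" and X = "\<lambda>p c. X p (c + s)"
        and Y = "\<lambda>p c. Y p (c + s)" and act = "\<lambda>p c. act p (c + s)" and \<alpha> = \<alpha> and \<beta> = \<beta>
        and n\<^sub>A = \<alpha> and n\<^sub>B = \<beta> and w = "1 / (20 * real d)"])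
    show "{..<N} \<noteq> {}" using dM by auto
    show "X p (c + s) \<subseteq> {..<N} \<and> card (X p (c + s)) = \<alpha> p"
      if "p \<in> L" "c \<in> {1..d}" "act p (c + s)" for p c using X[OF that(1) cs[OF that(2)] that(3)] .
    show "Y p (c + s) \<subseteq> {..<N} \<and> card (Y p (c + s)) = \<beta> p"
      if "p \<in> L" "c \<in> {1..d}" "act p (c + s)" for p c using Y[OF that(1) cs[OF that(2)] that(3)] .
    show "card {c \<in> {1..d}. act p (c + s) \<and> x \<in> X p (c + s)} \<le> \<alpha> p" if "p \<in> L" for p x
      by (rule order_trans[OF shift[of "\<lambda>t. act p t \<and> x \<in> X p t"] nA[OF that, of x]])
    show "card {c \<in> {1..d}. act p (c + s) \<and> y \<in> Y p (c + s)} \<le> \<beta> p" if "p \<in> L" for p y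
      by (rule order_trans[OF shift[of "\<lambda>t. act p t \<and> y \<in> Y p t"] nB[OF that, of y]])
    show "Y p (c + s) \<inter> Y q (c + s) = {}"
      if "p \<in> L" "q \<in> L" "p \<noteq> q" "act p (c + s)" "act q (c + s)" for p q c
      using disj[of p q "c + s"] disj[of q p "c + s"] that by (metis Int_commute linorder_neqE_nat)
    show "1 / (20 * real d) \<le> real (\<alpha> p) * real (\<beta> p) / real (card {..<N}) ^ 2 *
        (1 - (real (\<beta> p) * real (\<alpha> p) / real (card {..<N}) + real (\<alpha> p) * real (\<beta> p) / real (card {..<N})))"
      if "p \<in> L" for p
    proof -
      have eq: "real (\<alpha> p) * real (\<beta> p) = real M" "real (\<beta> p) * real (\<alpha> p) = real M"
        by (metis of_nat_mult prod[OF that], metis of_nat_mult prod[OF that] mult.commute)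
      show ?thesis
        unfolding cardN eq by (rule thinning_weight[OF T dM(2)[unfolded N] M(1)])
    qed
  next
    fix E' lev z
    assume E': "E' \<subseteq> E"
      and keep: "\<And>e. e \<in> E' \<Longrightarrow> lev e \<in> L \<and> act (lev e) (\<chi> e + s) \<and>
        z (fst e) \<in> X (lev e) (\<chi> e + s) \<and> z (snd e) \<in> Y (lev e) (\<chi> e + s)"
      and dist: "\<And>e f. e \<in> E' \<Longrightarrow> f \<in> E' \<Longrightarrow> e \<noteq> f \<Longrightarrow> fst e = fst f \<or> snd e = snd f \<Longrightarrow> lev e \<noteq> lev f"
      and size: "1 / (20 * real d) * (\<Sum>e\<in>E. real (card {p \<in> L. act p (\<chi> e + s)})) \<le> real (card E')"
    have "0 < 20 * real d" using M(1,2) by simp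
    then have "(\<Sum>e\<in>E. real (card {p \<in> L. act p (\<chi> e + s)})) \<le> 20 * real d * real (card E')"
      using size by (simp only: pos_divide_le_eq times_divide_eq_left mult_1 mult.commute)
    then have "real r * (\<Sum>e\<in>E. real (card {p \<in> L. act p (\<chi> e + s)})) \<le> real r * (20 * real d * real (card E'))"
      by (intro mult_left_mono) auto
    then show thesis using good by (intro that[OF E' keep dist]) (simp_all add: mult_ac)
  qed auto
qed

text \<open>Base 3 offers distinct digits for the colour, the \<open>B\<close>-end and the
  \<open>A\<close>-end without a carry. Demanding one zero digit costs a factor 3, which with the 20
  of \<open>shifted_thinning\<close> makes 60. The claim on walks covers all
  \<open>F \<subseteq> E'\<close> because later steps remove further edges.\<close>

lemma slow_levels:
  fixes E :: "('v \<times> 'v) set"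
  assumes bip: "bipartite_graph A B E" and proper: "proper_edge_coloring E \<chi> d"
    and m: "2 * 3 ^ m \<le> d" "d < 6 * 3 ^ m" and L: "L = {(m + 2) div 2..<m}"
  obtains E' lev where "E' \<subseteq> E" "lev \<in> E' \<rightarrow> L"
    and "\<And>e f. e \<in> E' \<Longrightarrow> f \<in> E' \<Longrightarrow> e \<noteq> f \<Longrightarrow> fst e = fst f \<or> snd e = snd f \<Longrightarrow> lev e \<noteq> lev f"
    and "real (card E) * real (card L) \<le> 60 * real d * real (card E')"
    and "\<And>F k vs. F \<subseteq> E' \<Longrightarrow> 2 \<le> k \<Longrightarrow> B_slow_walk A B F \<chi> k vs \<Longrightarrow>
      \<exists>k' us. 2 \<le> k' \<and> k' < k \<and> slow_walk A B F lev k' us \<and> us ! 0 \<in> A"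
proof -
  define M where "M = (3::nat) ^ m"
  define N where "N = (d div M + 2) * M"
  define act where "act p t \<longleftrightarrow> t div 3 ^ p mod 3 = 0" for p t :: nat
  define X where "X p t = {x. x div 3 ^ p = t div 3 ^ p + 2}" for p t :: nat
  \<comment> \<open>Fixing the lowest \<open>2 * p - m\<close> digits cuts \<open>3 ^ p\<close>
    candidates down to \<open>3 ^ (m - p)\<close>, so the cardinalities for the two ends multiply to
    \<open>3 ^ m\<close> on every level. Levels above \<open>m / 2\<close> keep the natural
    subtraction exact.\<close>
  define Y where "Y p t = {y. y div 3 ^ p = t div 3 ^ p + 1 \<and> y mod 3 ^ (2 * p - m) = t mod 3 ^ (2 * p - m)}" for p t :: nat
  have pL: "p < m" "m < 2 * p" if "p \<in> L" for p using that by (auto simp: L)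
  have dvd: "3 ^ Suc p dvd N" if "p \<in> L" for p
    unfolding N_def M_def using pL[OF that] by (intro dvd_mult le_imp_power_dvd) simp
  have split: "(3::nat) ^ (2 * p - m) * 3 ^ (m - p) = 3 ^ p" if "p \<in> L" for p
    using pL[OF that] by (simp flip: power_add)
  have coarse: "y div 3 ^ P = t div 3 ^ P" if "act p t" "y \<in> Y p t \<union> X p t" "p < P" for p t y P
    using div_power_eq_of_low_digit[of t 3 p y 1 P] div_power_eq_of_low_digit[of t 3 p y 2 P] that
    by (auto simp: act_def X_def Y_def)
  have sub: "X p t \<subseteq> {..<N}" "Y p t \<subseteq> {..<N}" if "p \<in> L" "t < N" "act p t" for p t
  proof -
    have "y < N" if "y \<in> Y p t \<union> X p t" for y
      using less_of_div_eq[OF coarse[OF \<open>act p t\<close> that lessI] dvd[OF \<open>p \<in> L\<close>] \<open>t < N\<close>] .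
    then show "X p t \<subseteq> {..<N}" "Y p t \<subseteq> {..<N}" by auto
  qed
  have cardX: "card (X p t) = 3 ^ p" for p t unfolding X_def by (rule card_div_eq) simp
  have cardY: "card {y. y div 3 ^ p = g \<and> y mod 3 ^ (2 * p - m) = a} = 3 ^ (m - p)"
    if "p \<in> L" "a < 3 ^ (2 * p - m)" for p g a :: nat
    using card_div_mod_eq[of "3 ^ (m - p)" "3 ^ (2 * p - m)" a g] that(2) unfolding split[OF that(1)] by simp
  show thesis
  proof (rule shifted_thinning[OF bip proper, where M = M and N = N and L = L and act = act and X = X and Y = Y
        and r = 3 and \<alpha> = "\<lambda>p. 3 ^ p" and \<beta> = "\<lambda>p. 3 ^ (m - p)"])
    show "M > 0" "2 * M \<le> d" "d < 6 * M" "finite L" "N = (d div M + 2) * M"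
      using m by (auto simp: M_def L N_def)
    show "act p (t mod M) = act p t" if "p \<in> L" for p t
      unfolding act_def M_def using digit_mod_power[OF pL(1)[OF that], of t 3] by simp
    show "M \<le> 3 * card {t. t < M \<and> act p t}" if "p \<in> L" for p
      unfolding act_def M_def by (rule card_one_zero_digit) simp
    show "X p t \<subseteq> {..<N} \<and> card (X p t) = 3 ^ p" if "p \<in> L" "t < N" "act p t" for p t
      using sub(1)[OF that] cardX by simp
    show "Y p t \<subseteq> {..<N} \<and> card (Y p t) = 3 ^ (m - p)" if "p \<in> L" "t < N" "act p t" for p t
      using sub(2)[OF that] cardY[OF that(1)] unfolding Y_def by simp
    show "card {t. t < N \<and> act p t \<and> x \<in> X p t} \<le> 3 ^ p" if "p \<in> L" for p x
    proof -
      have c: "card {t. t div 3 ^ p = x div 3 ^ p - 2} = 3 ^ p" by (rule card_div_eq) simp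
      then have "finite {t. t div 3 ^ p = x div 3 ^ p - 2}" by (intro card_ge_0_finite) simp
      then have "card {t. t < N \<and> act p t \<and> x \<in> X p t} \<le> card {t. t div 3 ^ p = x div 3 ^ p - 2}"
        by (rule card_mono) (unfold X_def, auto)
      then show ?thesis unfolding c .
    qed
    show "card {t. t < N \<and> act p t \<and> y \<in> Y p t} \<le> 3 ^ (m - p)" if "p \<in> L" for p y
    proof -
      let ?T = "{t. t div 3 ^ p = y div 3 ^ p - 1 \<and> t mod 3 ^ (2 * p - m) = y mod 3 ^ (2 * p - m)}"
      have c: "card ?T = 3 ^ (m - p)" by (rule cardY[OF that]) simp
      then have "finite ?T" by (intro card_ge_0_finite) simp
      then have "card {t. t < N \<and> act p t \<and> y \<in> Y p t} \<le> card ?T"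
        by (rule card_mono) (unfold Y_def, auto)
      then show ?thesis unfolding c .
    qed
    show "3 ^ p * 3 ^ (m - p) = M" if "p \<in> L" for p
      using pL[OF that] unfolding M_def by (simp flip: power_add)
    \<comment> \<open>At the higher position \<open>q\<close>, a value from \<open>Y p t\<close>
      agrees with \<open>t\<close>, whereas \<open>Y q t\<close> demands an excess of 1.\<close>
    show "Y p t \<inter> Y q t = {}" if "p < q" "act p t" for p q t
    proof -
      have "y \<notin> Y q t" if "y \<in> Y p t" for y
        using coarse[of p t y q] that \<open>p < q\<close> \<open>act p t\<close> unfolding Y_def[of q] by simp
      then show ?thesis by blast
    qed
  next
    fix E' lev z s
    assume E': "E' \<subseteq> E"
      and keep: "\<And>e. e \<in> E' \<Longrightarrow> lev e \<in> L \<and> act (lev e) (\<chi> e + s) \<and>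
          z (fst e) \<in> X (lev e) (\<chi> e + s) \<and> z (snd e) \<in> Y (lev e) (\<chi> e + s)"
      and dist: "\<And>e f. e \<in> E' \<Longrightarrow> f \<in> E' \<Longrightarrow> e \<noteq> f \<Longrightarrow> fst e = fst f \<or> snd e = snd f \<Longrightarrow> lev e \<noteq> lev f"
      and size: "real (card E) * real (card L) \<le> 20 * real 3 * real d * real (card E')"
    show thesis
    proof (rule that[OF E' _ dist])
      show "lev \<in> E' \<rightarrow> L" using keep by blast
      show "real (card E) * real (card L) \<le> 60 * real d * real (card E')" using size by simp
      fix F k vs
      assume F: "F \<subseteq> E'" and k: "2 \<le> k" and sw: "B_slow_walk A B F \<chi> k vs"
      define val cv where "val P v = z v div 3 ^ P" and "cv P c = (c + s) div 3 ^ P" for P c and v :: 'v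
      show "\<exists>k' us. 2 \<le> k' \<and> k' < k \<and> slow_walk A B F lev k' us \<and> us ! 0 \<in> A"
      proof (rule slow_walk_descent[where val = val and cv = cv, OF _ _ _ _ _ _ k sw])
        show "bipartite_graph A B F" using bip F E' by (auto simp: bipartite_graph_def)
        show "lev e \<noteq> lev f" if "e \<in> F" "f \<in> F" "e \<noteq> f" "fst e = fst f \<or> snd e = snd f" for e f
          using dist[of e f] that F by blast
        show "val P (fst e) = cv P (\<chi> e) \<and> val P (snd e) = cv P (\<chi> e)" if "e \<in> F" "lev e < P" for e P
          using keep[of e] coarse[OF _ _ that(2), of "\<chi> e + s"] that(1) F unfolding val_def cv_def by blast
        show "val (lev e) (fst e) = cv (lev e) (\<chi> e) + 2" if "e \<in> F" for e
          using keep[of e] that F unfolding val_def cv_def X_def by blast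
        show "val (lev e) (snd e) = cv (lev e) (\<chi> e) + 1" if "e \<in> F" for e
          using keep[of e] that F unfolding val_def cv_def Y_def by blast
        show "mono (cv P)" for P unfolding cv_def by (intro monoI div_le_mono) simp
      qed
    qed assumption+
  qed
qed

text \<open>Base 2 suffices because the two ends deviate from the colour at different positions,
  \<open>B\<close> at \<open>p\<close> and \<open>A\<close> at \<open>m - p\<close>. Demanding two
  zero digits costs a factor 4, hence 80. Levels above \<open>m / 2\<close> put every fine position
  below every level.\<close>

lemma fast_levels:
  fixes E :: "('v \<times> 'v) set"
  assumes bip: "bipartite_graph A B E" and proper: "proper_edge_coloring E \<chi> d"
    and m: "2 * 2 ^ m \<le> d" "d < 4 * 2 ^ m" and L: "L = {(m + 2) div 2..<m}"
  obtains E' lev where "E' \<subseteq> E" "lev \<in> E' \<rightarrow> L"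
    and "\<And>e f. e \<in> E' \<Longrightarrow> f \<in> E' \<Longrightarrow> e \<noteq> f \<Longrightarrow> fst e = fst f \<or> snd e = snd f \<Longrightarrow> lev e \<noteq> lev f"
    and "real (card E) * real (card L) \<le> 80 * real d * real (card E')"
    and "\<And>F k vs. F \<subseteq> E' \<Longrightarrow> 2 \<le> k \<Longrightarrow> fast_walk A B F \<chi> k vs \<Longrightarrow>
      \<exists>k' us. 2 \<le> k' \<and> k' < k \<and> slow_walk A B F lev k' us \<and> us ! 0 \<in> B"
proof -
  define M where "M = (2::nat) ^ m"
  define N where "N = (d div M + 2) * M"
  define act where "act p t \<longleftrightarrow> t div 2 ^ p mod 2 = 0 \<and> t div 2 ^ (m - p) mod 2 = 0" for p t :: nat
  define Z where "Z p t = {x. x div 2 ^ p = t div 2 ^ p + 1}" for p t :: nat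
  have pL: "p < m" "m < 2 * p" if "p \<in> L" for p using that by (auto simp: L)
  have coarse: "y div 2 ^ P = t div 2 ^ P" if "t div 2 ^ q mod 2 = 0" "y \<in> Z q t" "q < P" for q t y P :: nat
    using div_power_eq_of_low_digit[of t 2 q y 1 P] that unfolding Z_def by simp
  have sub: "Z q t \<subseteq> {..<N}" if "q < m" "t < N" "t div 2 ^ q mod 2 = 0" for q t
  proof
    fix y assume "y \<in> Z q t"
    moreover have "2 ^ Suc q dvd N"
      unfolding N_def M_def using that by (intro dvd_mult le_imp_power_dvd) simp
    ultimately show "y \<in> {..<N}" using less_of_div_eq[OF coarse[OF that(3) _ lessI] _ that(2)] by simp
  qed
  have cardZ: "card (Z q t) = 2 ^ q" for q t unfolding Z_def by (rule card_div_eq) simp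
  have cardZ': "card {t. t < N \<and> act p t \<and> x \<in> Z q t} \<le> 2 ^ q" for p q x
  proof -
    have c: "card {t. t div 2 ^ q = x div 2 ^ q - 1} = 2 ^ q" by (rule card_div_eq) simp
    then have "finite {t. t div 2 ^ q = x div 2 ^ q - 1}" by (intro card_ge_0_finite) simp
    then have "card {t. t < N \<and> act p t \<and> x \<in> Z q t} \<le> card {t. t div 2 ^ q = x div 2 ^ q - 1}"
      by (rule card_mono) (unfold Z_def, auto)
    then show ?thesis unfolding c .
  qed
  have q_less: "m - p < P" if "p \<in> L" "P \<in> L" for p P using pL[OF that(1)] pL[OF that(2)] by linarith
  show thesis
  proof (rule shifted_thinning[OF bip proper, where M = M and N = N and L = L and act = act
        and X = "\<lambda>p. Z (m - p)" and Y = Z and r = 4 and \<alpha> = "\<lambda>p. 2 ^ (m - p)" and \<beta> = "\<lambda>p. 2 ^ p"])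
    show "M > 0" "2 * M \<le> d" "d < 6 * M" "finite L" "N = (d div M + 2) * M"
      using m by (auto simp: M_def L N_def)
    show "act p (t mod M) = act p t" if "p \<in> L" for p t
    proof -
      have "m - p < m" using pL[OF that] by linarith
      then show ?thesis
        unfolding act_def M_def by (simp only: digit_mod_power pL(1)[OF that])
    qed
    show "M \<le> 4 * card {t. t < M \<and> act p t}" if "p \<in> L" for p
    proof -
      have "m - p < p" using pL[OF that] by linarith
      then have "2 ^ m \<le> 2 * 2 * card {t. t < M \<and> act p t}"
        unfolding act_def M_def by (rule card_two_zero_digits[rotated]) simp
      then show ?thesis by (simp add: M_def)
    qed
    show "Z (m - p) t \<subseteq> {..<N} \<and> card (Z (m - p) t) = 2 ^ (m - p)" if "p \<in> L" "t < N" "act p t" for p t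
    proof -
      have "m - p < m" using pL[OF that(1)] by linarith
      moreover have "t div 2 ^ (m - p) mod 2 = 0" using that(3) unfolding act_def by (rule conjunct2)
      ultimately show ?thesis by (intro conjI sub[OF _ that(2)] cardZ)
    qed
    show "Z p t \<subseteq> {..<N} \<and> card (Z p t) = 2 ^ p" if "p \<in> L" "t < N" "act p t" for p t
    proof -
      have "t div 2 ^ p mod 2 = 0" using that(3) unfolding act_def by (rule conjunct1)
      then show ?thesis by (intro conjI sub[OF pL(1)[OF that(1)] that(2)] cardZ)
    qed
    show "2 ^ (m - p) * 2 ^ p = M" if "p \<in> L" for p
      using pL[OF that] unfolding M_def by (simp flip: power_add)
    show "Z p t \<inter> Z q t = {}" if "p < q" "act p t" for p q t
    proof -
      have "y \<notin> Z q t" if "y \<in> Z p t" for y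
        using coarse[OF _ that \<open>p < q\<close>] \<open>act p t\<close> unfolding Z_def[of q] act_def by simp
      then show ?thesis by blast
    qed
  next
    fix E' lev z s
    assume E': "E' \<subseteq> E"
      and keep: "\<And>e. e \<in> E' \<Longrightarrow> lev e \<in> L \<and> act (lev e) (\<chi> e + s) \<and>
          z (fst e) \<in> Z (m - lev e) (\<chi> e + s) \<and> z (snd e) \<in> Z (lev e) (\<chi> e + s)"
      and dist: "\<And>e f. e \<in> E' \<Longrightarrow> f \<in> E' \<Longrightarrow> e \<noteq> f \<Longrightarrow> fst e = fst f \<or> snd e = snd f \<Longrightarrow> lev e \<noteq> lev f"
      and size: "real (card E) * real (card L) \<le> 20 * real 4 * real d * real (card E')"
    show thesis
    proof (rule that[OF E' _ dist])
      show "lev \<in> E' \<rightarrow> L" using keep by blast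
      show "real (card E) * real (card L) \<le> 80 * real d * real (card E')" using size by simp
      fix F k vs
      assume F: "F \<subseteq> E'" and k: "2 \<le> k" and fw: "fast_walk A B F \<chi> k vs"
      define val cv where "val P v = z v div 2 ^ P" and "cv P c = (c + s) div 2 ^ P" for P c and v :: 'v
      have mono: "mono (cv P)" for P unfolding cv_def by (intro monoI div_le_mono) simp
      show "\<exists>k' us. 2 \<le> k' \<and> k' < k \<and> slow_walk A B F lev k' us \<and> us ! 0 \<in> B"
      proof (rule fast_walk_descent[where val = val and cv = cv, OF _ _ _ _ _ _ mono k fw])
        show "bipartite_graph A B F" using bip F E' by (auto simp: bipartite_graph_def)
        show "lev e \<noteq> lev f" if "e \<in> F" "f \<in> F" "e \<noteq> f" "fst e = fst f \<or> snd e = snd f" for e f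
          using dist[of e f] that F by blast
        show "val (lev f) (fst e) = cv (lev f) (\<chi> e)" if ef: "e \<in> F" "f \<in> F" for e f
        proof -
          have "(\<chi> e + s) div 2 ^ (m - lev e) mod 2 = 0" "z (fst e) \<in> Z (m - lev e) (\<chi> e + s)" "m - lev e < lev f"
            using keep[of e] keep[of f] q_less ef F unfolding act_def by auto
          then show ?thesis unfolding val_def cv_def by (rule coarse)
        qed
        show "val (lev f) (snd e) = cv (lev f) (\<chi> e)" if ef: "e \<in> F" "f \<in> F" "lev e < lev f" for e f
        proof -
          have "(\<chi> e + s) div 2 ^ lev e mod 2 = 0" "z (snd e) \<in> Z (lev e) (\<chi> e + s)"
            using keep[of e] ef F unfolding act_def by auto
          then show ?thesis using ef(3) unfolding val_def cv_def by (rule coarse)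
        qed
        show "val (lev e) (snd e) = cv (lev e) (\<chi> e) + 1" if "e \<in> F" for e
          using keep[of e] that F unfolding val_def cv_def Z_def by blast
        show "\<chi> e < \<chi> f" if ef: "e \<in> F" "f \<in> F" "fst e = fst f" "lev e < lev f" for e f
        proof -
          have e: "lev e \<in> L" "act (lev e) (\<chi> e + s)" "z (fst e) \<in> Z (m - lev e) (\<chi> e + s)"
            and f: "lev f \<in> L" "act (lev f) (\<chi> f + s)" "z (fst e) \<in> Z (m - lev f) (\<chi> f + s)"
            using keep[of e] keep[of f] ef F by auto
          \<comment> \<open>A larger level has a smaller fine position. So at the fine position of
            \<open>e\<close> the number of the common vertex agrees with the colour of
            \<open>f\<close>, while it exceeds that of \<open>e\<close> by 1.\<close>
          have "m - lev f < m - lev e" using ef(4) pL[OF f(1)] by linarith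
          then have "z (fst e) div 2 ^ (m - lev e) = cv (m - lev e) (\<chi> f)"
            unfolding cv_def by (rule coarse[OF conjunct2[OF f(2)[unfolded act_def]] f(3)])
          moreover have "z (fst e) div 2 ^ (m - lev e) = cv (m - lev e) (\<chi> e) + 1"
            using e(3) unfolding Z_def cv_def by blast
          ultimately have "cv (m - lev e) (\<chi> e) < cv (m - lev e) (\<chi> f)" by linarith
          then show ?thesis using monoD[OF mono] by (meson not_le)
        qed
      qed
    qed assumption+
  \<comment> \<open>Both counting obligations remain, one per side, with \<open>q = m - p\<close>
    and \<open>q = p\<close>.\<close>
  qed (rule cardZ')+
qed

section \<open>Numerical estimates and the constant 240\<close>

lemma card_levels_ge:
  "m \<le> 2 * card {(m + 2) div 2..<m} + 2"
  by simp

text \<open>The factor 2 provides the room \<open>2 * M \<le> d\<close> that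
  \<open>shifted_thinning\<close> asks for.\<close>

lemma ex_power_bracket:
  fixes b d :: nat
  assumes "2 \<le> b" "2 \<le> d"
  obtains m where "2 * b ^ m \<le> d" "d < 2 * b ^ Suc m"
proof -
  obtain m where "b ^ m \<le> d div 2" "d div 2 < b ^ Suc m"
    using ex_power_ivl1[OF assms(1), of "d div 2"] assms(2) by (auto simp: Suc_le_eq div_greater_zero_iff)
  then show thesis by (intro that[of m]) linarith+
qed

lemma log_less_of_less_power:
  fixes d b m :: nat
  assumes "0 < d" "2 \<le> b" "d < 2 * b ^ Suc m"
  shows "log 2 (real d) < 1 + (real m + 1) * log 2 (real b)"
proof -
  have "real d < 2 * real b ^ Suc m" using assms(3)[THEN less_imp_of_nat_less[where 'a = real]] by (simp only: of_nat_mult of_nat_power of_nat_numeral)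
  then have "log 2 (real d) < log 2 (2 * real b ^ Suc m)" using assms by simp
  also have "\<dots> = 1 + (real m + 1) * log 2 (real b)"
    using assms by (simp add: log_mult log_nat_power add.commute del: power_Suc)
  finally show ?thesis .
qed

text \<open>This is \<open>3 ^ 5 = 243 \<le> 256 = 2 ^ 8\<close>.\<close>

lemma log_2_3_le: "log 2 3 \<le> 8 / (5::real)"
proof -
  have "5 * log 2 3 = log 2 ((3::real) ^ 5)" using log_nat_power[of 3 2 5] by simp
  also have "\<dots> \<le> log 2 (2 ^ 8)" by (subst log_le_cancel_iff) auto
  also have "\<dots> = 8" using log_nat_power[of 2 2 8] by simp
  finally show ?thesis by simp
qed

lemma proper_of_levels:
  fixes m d\<^sub>1 :: nat
  assumes "lev \<in> E' \<rightarrow> {(m + 2) div 2..<m}" "m \<le> d\<^sub>1"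
    and "\<And>e f. e \<in> E' \<Longrightarrow> f \<in> E' \<Longrightarrow> e \<noteq> f \<Longrightarrow> fst e = fst f \<or> snd e = snd f \<Longrightarrow> lev e \<noteq> lev f"
  shows "proper_edge_coloring E' lev d\<^sub>1"
proof -
  have "lev e \<in> {1..d\<^sub>1}" if "e \<in> E'" for e
    using funcset_mem[OF assms(1) that] assms(2) by auto
  then show ?thesis using assms(3) unfolding proper_edge_coloring_def by blast
qed

text \<open>The new palette size \<open>d\<^sub>1\<close> replaces the logarithm in the edge count,
  so that it cancels the \<open>1 / d\<^sub>1\<close> of the next density bound.\<close>

definition thins_to :: "('v \<times> 'v) set \<Rightarrow> nat \<Rightarrow> ('v \<times> 'v) set \<Rightarrow> nat \<Rightarrow> bool" where
  "thins_to E d E' d\<^sub>1 \<longleftrightarrow> E' \<subseteq> E \<and> log 2 (real d) \<le> real d\<^sub>1 \<and> 0 < d\<^sub>1 \<and>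
     real d\<^sub>1 * real (card E) \<le> 240 * real d * real (card E')"

lemma slow_thinning:
  assumes bip: "bipartite_graph A B E" and proper: "proper_edge_coloring E \<chi> d"
    and d: "0 < d" "40 \<le> log 2 (real d)"
  obtains E' lev d\<^sub>1 where "thins_to E d E' d\<^sub>1" "proper_edge_coloring E' lev d\<^sub>1"
    and "\<And>F k vs. F \<subseteq> E' \<Longrightarrow> 2 \<le> k \<Longrightarrow> B_slow_walk A B F \<chi> k vs \<Longrightarrow>
      \<exists>k' us. 2 \<le> k' \<and> k' < k \<and> slow_walk A B F lev k' us \<and> us ! 0 \<in> A"
proof -
  define d\<^sub>1 where "d\<^sub>1 = nat \<lceil>log 2 (real d)\<rceil>"
  have d1: "log 2 (real d) \<le> real d\<^sub>1" "real d\<^sub>1 \<le> log 2 (real d) + 1" using d by (auto simp: d\<^sub>1_def)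
  have d2: "2 \<le> d"
  proof (rule ccontr)
    assume "\<not> 2 \<le> d"
    then have "d = 1" using d(1) by simp
    then show False using d(2) by simp
  qed
  obtain m where m: "2 * 3 ^ m \<le> d" "d < 2 * 3 ^ Suc m"
    by (rule ex_power_bracket[of 3, OF _ d2]) auto
  have "(2::nat) ^ m \<le> 3 ^ m" by (rule power_mono) auto
  then have "2 ^ m \<le> d" using m by linarith
  then have md1: "m \<le> d\<^sub>1" using d1(1) le_log2_of_power[of m d] by linarith
  have "log 2 (real d) < 1 + (real m + 1) * log 2 3"
    using log_less_of_less_power[of d 3 m] m d2 by simp
  also have "\<dots> \<le> 1 + (real m + 1) * (8 / 5)"
    using log_2_3_le by (intro add_left_mono mult_left_mono) auto
  finally have lm: "5 * log 2 (real d) < 13 + 8 * real m" by (simp add: field_simps)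
  \<comment> \<open>Up to lower-order terms, \<open>d\<^sub>1\<close> is at most
    \<open>8 / 5 * m\<close>, that is \<open>16 / 5\<close> times the number of levels. Rounding up
    to 4 absorbs these terms once the logarithm is at least 40, and \<open>4 * 60\<close> is
    240.\<close>
  have "real d\<^sub>1 \<le> 4 * c" if "real m \<le> 2 * c + 2" for c
    using that lm d1 d(2) by linarith
  moreover have "real m \<le> 2 * real (card {(m + 2) div 2..<m}) + 2"
    using card_levels_ge[of m] by linarith
  ultimately have L: "real d\<^sub>1 \<le> 4 * real (card {(m + 2) div 2..<m})" by blast
  have "d < 6 * 3 ^ m" using m by simp
  then show thesis
  proof (rule slow_levels[OF bip proper m(1) _ refl])
    fix E' lev
    assume E': "E' \<subseteq> E" and lev: "lev \<in> E' \<rightarrow> {(m + 2) div 2..<m}"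
      and dist: "\<And>e f. e \<in> E' \<Longrightarrow> f \<in> E' \<Longrightarrow> e \<noteq> f \<Longrightarrow> fst e = fst f \<or> snd e = snd f \<Longrightarrow> lev e \<noteq> lev f"
      and size: "real (card E) * real (card {(m + 2) div 2..<m}) \<le> 60 * real d * real (card E')"
      and walks: "\<And>F k vs. F \<subseteq> E' \<Longrightarrow> 2 \<le> k \<Longrightarrow> B_slow_walk A B F \<chi> k vs \<Longrightarrow>
        \<exists>k' us. 2 \<le> k' \<and> k' < k \<and> slow_walk A B F lev k' us \<and> us ! 0 \<in> A"
    have "real d\<^sub>1 * real (card E) \<le> 4 * real (card {(m + 2) div 2..<m}) * real (card E)"
      using L by (intro mult_right_mono) auto
    also have "\<dots> = 4 * (real (card E) * real (card {(m + 2) div 2..<m}))" by (simp only: mult_ac)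
    also have "\<dots> \<le> 4 * (60 * real d * real (card E'))" using size by (intro mult_left_mono) simp_all
    also have "\<dots> = 240 * real d * real (card E')" by simp
    finally have "thins_to E d E' d\<^sub>1" using E' d1 d unfolding thins_to_def by auto
    then show thesis by (rule that[OF _ proper_of_levels[OF lev md1 dist] walks])
  qed
qed

lemma fast_thinning:
  assumes bip: "bipartite_graph A B E" and proper: "proper_edge_coloring E \<chi> d"
    and d: "0 < d" "40 \<le> log 2 (real d)"
  obtains E' lev d\<^sub>1 where "thins_to E d E' d\<^sub>1" "proper_edge_coloring E' lev d\<^sub>1"
    and "\<And>F k vs. F \<subseteq> E' \<Longrightarrow> 2 \<le> k \<Longrightarrow> fast_walk A B F \<chi> k vs \<Longrightarrow>
      \<exists>k' us. 2 \<le> k' \<and> k' < k \<and> slow_walk A B F lev k' us \<and> us ! 0 \<in> B"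
proof -
  define d\<^sub>1 where "d\<^sub>1 = nat \<lceil>log 2 (real d)\<rceil>"
  have d1: "log 2 (real d) \<le> real d\<^sub>1" "real d\<^sub>1 \<le> log 2 (real d) + 1" using d by (auto simp: d\<^sub>1_def)
  have d2: "2 \<le> d"
  proof (rule ccontr)
    assume "\<not> 2 \<le> d"
    then have "d = 1" using d(1) by simp
    then show False using d(2) by simp
  qed
  obtain m where m: "2 * 2 ^ m \<le> d" "d < 2 * 2 ^ Suc m"
    by (rule ex_power_bracket[of 2, OF _ d2]) auto
  then have "2 ^ m \<le> d" by linarith
  then have md1: "m \<le> d\<^sub>1" using d1(1) le_log2_of_power[of m d] by linarith
  have "log 2 (real d) < real m + 2"
    using log_less_of_less_power[of d 2 m] m d2 by simp
  moreover have "real m \<le> 2 * real (card {(m + 2) div 2..<m}) + 2"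
    using card_levels_ge[of m] by linarith
  \<comment> \<open>Here the leading factor is 2, and 3 absorbs the lower-order terms;
    \<open>3 * 80\<close> is again 240.\<close>
  ultimately have L: "real d\<^sub>1 \<le> 3 * real (card {(m + 2) div 2..<m})" using d1 d by simp
  have "d < 4 * 2 ^ m" using m by simp
  then show thesis
  proof (rule fast_levels[OF bip proper m(1) _ refl])
    fix E' lev
    assume E': "E' \<subseteq> E" and lev: "lev \<in> E' \<rightarrow> {(m + 2) div 2..<m}"
      and dist: "\<And>e f. e \<in> E' \<Longrightarrow> f \<in> E' \<Longrightarrow> e \<noteq> f \<Longrightarrow> fst e = fst f \<or> snd e = snd f \<Longrightarrow> lev e \<noteq> lev f"
      and size: "real (card E) * real (card {(m + 2) div 2..<m}) \<le> 80 * real d * real (card E')"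
      and walks: "\<And>F k vs. F \<subseteq> E' \<Longrightarrow> 2 \<le> k \<Longrightarrow> fast_walk A B F \<chi> k vs \<Longrightarrow>
        \<exists>k' us. 2 \<le> k' \<and> k' < k \<and> slow_walk A B F lev k' us \<and> us ! 0 \<in> B"
    have "real d\<^sub>1 * real (card E) \<le> 3 * real (card {(m + 2) div 2..<m}) * real (card E)"
      using L by (intro mult_right_mono) auto
    also have "\<dots> = 3 * (real (card E) * real (card {(m + 2) div 2..<m}))" by (simp only: mult_ac)
    also have "\<dots> \<le> 3 * (80 * real d * real (card E'))" using size by (intro mult_left_mono) simp_all
    also have "\<dots> = 240 * real d * real (card E')" by simp
    finally have "thins_to E d E' d\<^sub>1" using E' d1 d unfolding thins_to_def by auto
    then show thesis by (rule that[OF _ proper_of_levels[OF lev md1 dist] walks])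
  qed
qed

subsection \<open>Iteration\<close>

text \<open>A positive last iterate excludes the default value 0 at every stage, so the innermost
  logarithm can be split off instead of the outermost one.\<close>

lemma iterated_log_shift:
  assumes "0 < x" "0 < iterated_log (Suc n) x"
  shows "iterated_log (Suc n) x = iterated_log n (log 2 x)"
  using assms(2)
proof (induction n)
  case 0
  then show ?case using assms(1) by simp
next
  case (Suc n)
  have pos: "0 < iterated_log (Suc n) x"
    using Suc.prems by (metis iterated_log.simps(2) less_irrefl)
  then show ?case using Suc.IH[OF pos] by (metis iterated_log.simps(2))
qed

lemma iterated_log_mono:
  assumes "x \<le> y" "0 < iterated_log n x"
  shows "iterated_log n x \<le> iterated_log n y"
  using assms(2)
proof (induction n)
  case (Suc n)
  have pos: "0 < iterated_log n x" using Suc.prems by (auto split: if_splits)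
  then have "iterated_log n x \<le> iterated_log n y" by (rule Suc.IH)
  then show ?case using pos by simp
qed (use assms(1) in simp)

text \<open>By the tangent of \<open>ln\<close> at 2,
  \<open>ln u \<le> u / 2 - 1 + ln 2 \<le> u * ln 2\<close>, since
  \<open>1 / 2 \<le> ln 2 < 1\<close>.\<close>

lemma log_2_le_self:
  fixes u :: real
  assumes "0 < u"
  shows "log 2 u \<le> u"
proof -
  have "ln u - ln 2 \<le> u / 2 - 1" using ln_le_minus_one[of "u / 2"] assms by (simp add: ln_div)
  moreover have "1 / 2 \<le> ln (2::real)"
  proof -
    have "1 \<le> ln (4::real)" using exp_le by (subst ln_ge_iff) auto
    also have "\<dots> = 2 * ln 2" using ln_realpow[of 2 2] by simp
    finally show ?thesis by simp
  qed
  then have "0 \<le> u * (ln 2 - 1 / 2)" using assms by simp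
  moreover have "ln 2 < (1::real)" by (rule ln_2_less_1)
  ultimately have "ln u \<le> u * ln 2" by (simp add: algebra_simps)
  then show ?thesis by (simp add: log_def divide_le_eq)
qed

text \<open>Converts a large iterated logarithm into the lower bound on \<open>log 2 d\<close> that
  the thinning lemmas require.\<close>

lemma iterated_log_le_log:
  assumes "0 < x" "0 < iterated_log (Suc n) x"
  shows "iterated_log (Suc n) x \<le> log 2 x"
  using assms(2)
proof (induction n)
  case (Suc n)
  have pos: "0 < iterated_log (Suc n) x"
    using Suc.prems by (metis iterated_log.simps(2) less_irrefl)
  have "iterated_log (Suc (Suc n)) x = log 2 (iterated_log (Suc n) x)" using pos by (metis iterated_log.simps(2))
  then show ?case using Suc.IH[OF pos] log_2_le_self[OF pos] by linarith
qed (use assms(1) in simp)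

section \<open>Edge densities along the iteration and the small case\<close>

definition density_bound :: "nat \<Rightarrow> nat \<Rightarrow> real" where
  "density_bound n d = iterated_log n (real d) / (4 * 240 ^ n * real d)"

text \<open>Consecutive bounds differ by the factor 240 of \<open>thins_to\<close>, the palette size
  \<open>d\<^sub>1\<close> cancels, and \<open>log 2 d \<le> d\<^sub>1\<close> is passed through the
  monotone iterated logarithm.\<close>

lemma density_bound_step:
  assumes thin: "thins_to E d E\<^sub>1 d\<^sub>1" and "0 < d"
    and pos: "0 < iterated_log (Suc n) (real d)"
    and E2: "density_bound n d\<^sub>1 * real (card E\<^sub>1) < real (card E\<^sub>2)"
  shows "density_bound (Suc n) d * real (card E) < real (card E\<^sub>2)"
proof -
  define y where "y = iterated_log (Suc n) (real d)"
  have y: "y = iterated_log n (log 2 (real d))"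
    unfolding y_def by (rule iterated_log_shift) (use assms in auto)
  have dd: "log 2 (real d) \<le> real d\<^sub>1" "0 < real d\<^sub>1" "real d\<^sub>1 * real (card E) \<le> 240 * real d * real (card E\<^sub>1)"
    using thin by (auto simp: thins_to_def)
  have ypos: "0 < y" using pos by (simp only: y_def)
  have le: "y \<le> iterated_log n (real d\<^sub>1)"
    unfolding y by (rule iterated_log_mono[OF dd(1)]) (use ypos y in simp)
  have "density_bound (Suc n) d * real (card E) = y / (4 * 240 ^ n) / real d\<^sub>1 * (real d\<^sub>1 * real (card E) / (240 * real d))"
    unfolding density_bound_def y_def[symmetric] using dd(2) by (simp add: field_simps)
  also have "\<dots> \<le> y / (4 * 240 ^ n) / real d\<^sub>1 * real (card E\<^sub>1)"
    using dd ypos \<open>0 < d\<close> by (intro mult_left_mono) (simp_all add: pos_divide_le_eq mult.commute)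
  also have "\<dots> \<le> iterated_log n (real d\<^sub>1) / (4 * 240 ^ n) / real d\<^sub>1 * real (card E\<^sub>1)"
    using le dd by (intro mult_right_mono divide_right_mono) auto
  also have "\<dots> = density_bound n d\<^sub>1 * real (card E\<^sub>1)" by (simp add: density_bound_def mult_ac)
  also have "\<dots> < real (card E\<^sub>2)" by (rule E2)
  finally show ?thesis .
qed

lemma large_color_class:
  assumes "finite E" "\<chi> \<in> E \<rightarrow> {1..d}" "0 < d"
  obtains c where "real (card E) \<le> real d * real (card {e \<in> E. \<chi> e = c})"
proof -
  have "card E = (\<Sum>c\<in>{1..d}. card {e \<in> E. \<chi> e = c})"
    using sum.group[OF assms(1) _ image_subsetI, of "{1..d}" \<chi> "\<lambda>_. 1 :: nat"] funcset_mem[OF assms(2)] by simp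
  then have "real (card {1..d}) * (real (card E) / real d) \<le> (\<Sum>c\<in>{1..d}. real (card {e \<in> E. \<chi> e = c}))"
    using assms(3) by (simp flip: of_nat_sum)
  from exists_ge_average[OF _ _ this] obtain c where "real (card E) / real d \<le> real (card {e \<in> E. \<chi> e = c})"
    using assms(3) by auto
  then show thesis using assms(3) by (intro that[of c]) (simp add: pos_divide_le_eq mult.commute)
qed

text \<open>A largest colour class has at least \<open>card E / d\<close> edges, and
  \<open>small\<close> puts the required bound below that. As a matching it contains no walk of
  length 2 or more.\<close>

lemma monochromatic_subgraph:
  assumes bip: "bipartite_graph A B E" and proper: "proper_edge_coloring E \<chi> d" and "E \<noteq> {}"
    and small: "iterated_log n (real d) < 4 * 240 ^ n"
  obtains E' where "E' \<subseteq> E" "density_bound n d * real (card E) < real (card E')"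
    and "\<And>m vs. 2 \<le> m \<Longrightarrow> \<not> is_walk A B E' m vs"
proof -
  have finE: "finite E" using bip unfolding bipartite_graph_def by (meson finite_SigmaI finite_subset)
  have col: "\<chi> \<in> E \<rightarrow> {1..d}" using proper by (simp add: proper_edge_coloring_def)
  then have d: "0 < d" using \<open>E \<noteq> {}\<close> by fastforce
  obtain c where c: "real (card E) \<le> real d * real (card {e \<in> E. \<chi> e = c})"
    using large_color_class[OF finE col d] .
  show thesis
  proof (rule that[of "{e \<in> E. \<chi> e = c}"])
    have "0 < real (card E)" using finE \<open>E \<noteq> {}\<close> by (simp add: card_gt_0_iff)
    moreover have "iterated_log n (real d) / (4 * 240 ^ n) < 1" using small by simp
    ultimately have "iterated_log n (real d) / (4 * 240 ^ n) * real (card E) < 1 * real (card E)"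
      by (intro mult_strict_right_mono)
    also have "\<dots> \<le> real (card {e \<in> E. \<chi> e = c}) * real d" using c by (simp add: mult.commute)
    finally have "iterated_log n (real d) / (4 * 240 ^ n) * real (card E) / real d < real (card {e \<in> E. \<chi> e = c})"
      using d by (simp only: pos_divide_less_eq of_nat_0_less_iff)
    then show "density_bound n d * real (card E) < real (card {e \<in> E. \<chi> e = c})"
      by (simp add: density_bound_def mult_ac)
    fix m vs assume m: "2 \<le> (m::nat)"
    show "\<not> is_walk A B {e \<in> E. \<chi> e = c} m vs"
    proof
      assume walk: "is_walk A B {e \<in> E. \<chi> e = c} m vs"
      have b: "bipartite_graph A B {e \<in> E. \<chi> e = c}" using bip by (auto simp: bipartite_graph_def)
      have "walk_edge {e \<in> E. \<chi> e = c} vs 1 \<in> {e \<in> E. \<chi> e = c}" "walk_edge {e \<in> E. \<chi> e = c} vs (Suc 1) \<in> {e \<in> E. \<chi> e = c}"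
        using walk_edge_mem[OF b walk] m by auto
      then show False
        using walk_edge_consec[OF b walk, of 1] m proper unfolding proper_edge_coloring_def
        by (metis (mono_tags, lifting) Suc_1 le_refl less_le_trans lessI mem_Collect_eq)
    qed
  qed auto
qed

section \<open>Exchange of the sides and the induction\<close>

lemma slow_coloring_cong:
  assumes "\<And>i. 1 \<le> i \<Longrightarrow> i \<le> 2 * k \<Longrightarrow> c i = c' i" "1 \<le> k"
  shows "slow_coloring k c = slow_coloring k c'"
  unfolding slow_coloring_iff using assms(1)[of 1] assms(1)[of "2 * k"] assms(2)
  by (intro arg_cong2[of _ _ _ _ "(\<and>)"] all_cong) (auto simp: assms(1))

text \<open>Slow walks in the levels start in \<open>A\<close>, whereas the induction excludes those
  from the second side. Transposing the edges makes \<open>A\<close> the second side.\<close>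

lemma slow_walk_converse:
  assumes bip: "bipartite_graph A B F" and k: "1 \<le> k" and sw: "slow_walk A B F \<chi> k us"
  shows "slow_walk B A (F\<inverse>) (\<chi> \<circ> prod.swap) k us"
proof -
  have walk: "is_walk A B F (2 * k) us" and sc: "slow_coloring k (walk_coloring F \<chi> us)"
    using sw by (auto simp: slow_walk_def)
  have "walk_coloring F \<chi> us i = walk_coloring (F\<inverse>) (\<chi> \<circ> prod.swap) us i" if "1 \<le> i" "i \<le> 2 * k" for i
  proof -
    have "adj F (us ! (i - 1)) (us ! i)" using walk that unfolding is_walk_def by auto
    \<comment> \<open>Only one orientation of an edge is present when the sides are disjoint, so
      both case distinctions of \<open>edge_color\<close> pick the same edge.\<close>
    then show ?thesis using bip unfolding walk_coloring_def edge_color_def adj_def bipartite_graph_def by auto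
  qed
  then have "slow_coloring k (walk_coloring (F\<inverse>) (\<chi> \<circ> prod.swap) us)"
    using sc slow_coloring_cong[OF _ k] by blast
  moreover have "is_walk B A (F\<inverse>) (2 * k) us"
    using walk unfolding is_walk_def adj_def by auto
  ultimately show ?thesis by (simp add: slow_walk_def)
qed

lemma bipartite_graph_converse: "bipartite_graph A B E \<Longrightarrow> bipartite_graph B A (E\<inverse>)"
  by (auto simp: bipartite_graph_def)

lemma proper_edge_coloring_converse:
  "proper_edge_coloring E \<chi> d \<Longrightarrow> proper_edge_coloring (E\<inverse>) (\<chi> \<circ> prod.swap) d"
  unfolding proper_edge_coloring_def by fastforce

lemma thins_to_nonempty:
  assumes "thins_to E d E' d\<^sub>1" "finite E" "E \<noteq> {}"
  shows "E' \<noteq> {}"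
proof
  assume "E' = {}"
  then have "real d\<^sub>1 * real (card E) \<le> 0" using assms(1) by (simp add: thins_to_def)
  moreover have "0 < real d\<^sub>1 * real (card E)" using assms by (simp add: thins_to_def card_gt_0_iff)
  ultimately show False by linarith
qed

text \<open>Induction on \<open>n = k - 1\<close>. All graph data are generalised because each step
  passes to the levels as colours and exchanges the sides.\<close>

lemma slow_free_subgraph:
  fixes A B :: "'v set"
  assumes "bipartite_graph A B E" "E \<noteq> {}" "proper_edge_coloring E \<chi> d"
  shows "\<exists>E' \<subseteq> E. (\<forall>k\<in>{2..Suc n}. \<nexists>vs. B_slow_walk A B E' \<chi> k vs) \<and> density_bound n d * real (card E) < real (card E')"
  using assms
proof (induction n arbitrary: A B E \<chi> d)
  case 0
  \<comment> \<open>The range \<open>{2..1}\<close> is empty, so \<open>E\<close> itself works; the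
    bound is at most a quarter of its size, and \<open>E\<close> is nonempty.\<close>
  have "finite E" using "0.prems"(1) unfolding bipartite_graph_def by (meson finite_SigmaI finite_subset)
  then have "0 < card E" using "0.prems"(2) by (simp add: card_gt_0_iff)
  moreover have "density_bound 0 d \<le> 1 / 4" by (simp add: density_bound_def)
  then have "density_bound 0 d * real (card E) \<le> 1 / 4 * real (card E)" by (rule mult_right_mono) simp
  ultimately show ?case by (intro exI[of _ E]) auto
next
  case (Suc n)
  note bip = Suc.prems(1) and proper = Suc.prems(3)
  have finE: "finite E" using bip unfolding bipartite_graph_def by (meson finite_SigmaI finite_subset)
  have d: "0 < d" using Suc.prems(2) proper unfolding proper_edge_coloring_def by fastforce
  show ?case
  proof (cases "iterated_log (Suc n) (real d) < 4 * 240 ^ Suc n")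
    case True
    show ?thesis
    proof (rule monochromatic_subgraph[OF bip proper Suc.prems(2) True])
      fix E' assume E': "E' \<subseteq> E" "density_bound (Suc n) d * real (card E) < real (card E')"
        and no: "\<And>m vs. 2 \<le> m \<Longrightarrow> \<not> is_walk A B E' m vs"
      have "\<not> B_slow_walk A B E' \<chi> k vs" if "k \<in> {2..Suc (Suc n)}" for k vs
        using no[of "2 * k" vs] that by (auto simp: B_slow_walk_def slow_walk_def)
      then show ?thesis using E' by blast
    qed
  next
    case False
    have "(1::real) \<le> 240 ^ n" by simp
    then have big: "40 \<le> iterated_log (Suc n) (real d)" using False unfolding power_Suc by linarith
    then have pos: "0 < iterated_log (Suc n) (real d)" by linarith
    have "40 \<le> log 2 (real d)" using big iterated_log_le_log[OF _ pos] d by simp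
    then show ?thesis
    proof (rule slow_thinning[OF bip proper d])
      fix E\<^sub>1 lev d\<^sub>1
      assume thin: "thins_to E d E\<^sub>1 d\<^sub>1" and proper1: "proper_edge_coloring E\<^sub>1 lev d\<^sub>1"
        and walks: "\<And>F k vs. F \<subseteq> E\<^sub>1 \<Longrightarrow> 2 \<le> k \<Longrightarrow> B_slow_walk A B F \<chi> k vs \<Longrightarrow>
          \<exists>k' us. 2 \<le> k' \<and> k' < k \<and> slow_walk A B F lev k' us \<and> us ! 0 \<in> A"
      have E1: "E\<^sub>1 \<subseteq> E" using thin by (simp add: thins_to_def)
      have bip1: "bipartite_graph A B E\<^sub>1" using bip E1 by (auto simp: bipartite_graph_def)
      \<comment> \<open>From here on the converse graph is used, with \<open>A\<close> as its second
        side; the result is transposed back at the end.\<close>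
      have ne: "E\<^sub>1\<inverse> \<noteq> {}" using thins_to_nonempty[OF thin finE Suc.prems(2)] by auto
      obtain E\<^sub>2 where E2: "E\<^sub>2 \<subseteq> E\<^sub>1\<inverse>" "\<forall>k\<in>{2..Suc n}. \<nexists>vs. B_slow_walk B A E\<^sub>2 (lev \<circ> prod.swap) k vs"
        "density_bound n d\<^sub>1 * real (card (E\<^sub>1\<inverse>)) < real (card E\<^sub>2)"
        using Suc.IH[OF bipartite_graph_converse[OF bip1] ne proper_edge_coloring_converse[OF proper1]] by blast
      have F: "E\<^sub>2\<inverse> \<subseteq> E\<^sub>1" using E2(1) by auto
      have bipF: "bipartite_graph A B (E\<^sub>2\<inverse>)" using bip1 F by (auto simp: bipartite_graph_def)
      have "\<not> B_slow_walk A B (E\<^sub>2\<inverse>) \<chi> k vs" if k: "k \<in> {2..Suc (Suc n)}" for k vs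
      proof
        assume "B_slow_walk A B (E\<^sub>2\<inverse>) \<chi> k vs"
        then obtain k' us where us: "2 \<le> k'" "k' < k" "slow_walk A B (E\<^sub>2\<inverse>) lev k' us" "us ! 0 \<in> A"
          using walks[OF F] k by (meson atLeastAtMost_iff)
        have "slow_walk B A E\<^sub>2 (lev \<circ> prod.swap) k' us"
          using slow_walk_converse[OF bipF _ us(3)] us(1) by simp
        then show False using E2(2) us k unfolding B_slow_walk_def by auto
      qed
      moreover have "density_bound (Suc n) d * real (card E) < real (card (E\<^sub>2\<inverse>))"
        using density_bound_step[OF thin d pos] E2(3) by simp
      ultimately show ?thesis using F E1 by blast
    qed
  qed
qed

text \<open>The levels of a fast walk contain a slow walk that already starts in \<open>B\<close>,
  so one fast thinning followed by \<open>slow_free_subgraph\<close> suffices, without exchanging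
  sides.\<close>

lemma fast_free_subgraph:
  fixes A B :: "'v set"
  assumes bip: "bipartite_graph A B E" and "E \<noteq> {}" and proper: "proper_edge_coloring E \<chi> d"
  shows "\<exists>E' \<subseteq> E. (\<forall>k\<in>{2..Suc (Suc n)}. \<nexists>vs. fast_walk A B E' \<chi> k vs) \<and>
    density_bound (Suc n) d * real (card E) < real (card E')"
proof (cases "iterated_log (Suc n) (real d) < 4 * 240 ^ Suc n")
  case True
  show ?thesis
  proof (rule monochromatic_subgraph[OF bip proper \<open>E \<noteq> {}\<close> True])
    fix E' assume E': "E' \<subseteq> E" "density_bound (Suc n) d * real (card E) < real (card E')"
      and no: "\<And>m vs. 2 \<le> m \<Longrightarrow> \<not> is_walk A B E' m vs"
    have "\<not> fast_walk A B E' \<chi> k vs" if "k \<in> {2..Suc (Suc n)}" for k vs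
      using no[of "2 * k" vs] that by (auto simp: fast_walk_def)
    then show ?thesis using E' by blast
  qed
next
  case False
  have finE: "finite E" using bip unfolding bipartite_graph_def by (meson finite_SigmaI finite_subset)
  have d: "0 < d" using \<open>E \<noteq> {}\<close> proper unfolding proper_edge_coloring_def by fastforce
  have "(1::real) \<le> 240 ^ n" by simp
  then have big: "40 \<le> iterated_log (Suc n) (real d)" using False unfolding power_Suc by linarith
  then have pos: "0 < iterated_log (Suc n) (real d)" by linarith
  have "40 \<le> log 2 (real d)" using big iterated_log_le_log[OF _ pos] d by simp
  then show ?thesis
  proof (rule fast_thinning[OF bip proper d])
    fix E\<^sub>1 lev d\<^sub>1
    assume thin: "thins_to E d E\<^sub>1 d\<^sub>1" and proper1: "proper_edge_coloring E\<^sub>1 lev d\<^sub>1"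
      and walks: "\<And>F k vs. F \<subseteq> E\<^sub>1 \<Longrightarrow> 2 \<le> k \<Longrightarrow> fast_walk A B F \<chi> k vs \<Longrightarrow>
        \<exists>k' us. 2 \<le> k' \<and> k' < k \<and> slow_walk A B F lev k' us \<and> us ! 0 \<in> B"
    have E1: "E\<^sub>1 \<subseteq> E" using thin by (simp add: thins_to_def)
    have bip1: "bipartite_graph A B E\<^sub>1" using bip E1 by (auto simp: bipartite_graph_def)
    obtain E\<^sub>2 where E2: "E\<^sub>2 \<subseteq> E\<^sub>1" "\<forall>k\<in>{2..Suc n}. \<nexists>vs. B_slow_walk A B E\<^sub>2 lev k vs"
      "density_bound n d\<^sub>1 * real (card E\<^sub>1) < real (card E\<^sub>2)"
      using slow_free_subgraph[OF bip1 thins_to_nonempty[OF thin finE \<open>E \<noteq> {}\<close>] proper1] by blast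
    have "\<not> fast_walk A B E\<^sub>2 \<chi> k vs" if k: "k \<in> {2..Suc (Suc n)}" for k vs
    proof
      assume "fast_walk A B E\<^sub>2 \<chi> k vs"
      then obtain k' us where us: "2 \<le> k'" "k' < k" "slow_walk A B E\<^sub>2 lev k' us" "us ! 0 \<in> B"
        using walks[OF E2(1)] k by (meson atLeastAtMost_iff)
      then show False using E2(2) k unfolding B_slow_walk_def by auto
    qed
    then show ?thesis using density_bound_step[OF thin d pos E2(3)] E2(1) E1 by blast
  qed
qed

theorem theorem10:
  fixes A B :: "'v set" and E :: "('v \<times> 'v) set" and \<chi> :: "'v \<times> 'v \<Rightarrow> nat" and d k :: nat
  assumes "bipartite_graph A B E"
    and "E \<noteq> {}"
    and "proper_edge_coloring E \<chi> d"
    and "k \<ge> 2"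
  shows "(\<exists>E' \<subseteq> E.
            (\<forall>k'\<in>{2..k}. \<nexists>vs. B_slow_walk A B E' \<chi> k' vs) \<and>
            real (card E') >
              iterated_log (k - 1) (real d) / (4 * 240 ^ (k - 1) * real d) * real (card E))
       \<and> (\<exists>E'' \<subseteq> E.
            (\<forall>k'\<in>{2..k}. \<nexists>vs. fast_walk A B E'' \<chi> k' vs) \<and>
            real (card E'') >
              iterated_log (k - 1) (real d) / (4 * 240 ^ (k - 1) * real d) * real (card E))"
proof -
  \<comment> \<open>The fast case is indexed by \<open>k - 2\<close> because its first thinning
    spends one of the \<open>k - 1\<close> logarithms.\<close>
  have k: "k = Suc (k - 1)" "k - 1 = Suc (k - 2)" using assms(4) by simp_all
  show ?thesis
    using slow_free_subgraph[OF assms(1-3), of "k - 1"] fast_free_subgraph[OF assms(1-3), of "k - 2"]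
    unfolding density_bound_def k(1)[symmetric] k(2)[symmetric] by blast
qed

end
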